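(* If $m$ and $N$ are odd, then the group $H_*(I(\mathbb{RP}^m,N),\Theta\otimes\mathbb{Q})$ is trivial.
   Context: $I(X,N)\subset X^N$ is the space of ordered configurations of $N$ pairwise distinct points in $X$. Consider the non-trivial local system with fiber $\mathbb{Z}$ on $\mathbb{RP}^m$ (a generator of $\pi_1(\mathbb{RP}^m)$ acts on its fibers as multiplication by $-1$). $\Theta$ is the local system on $(\mathbb{RP}^m)^N$ which is the tensor product of the $N$ local systems lifted from these local systems on the factors by the standard projections; the same notation is used for its restriction to $I(\mathbb{RP}^m,N)$. *)

theory Defs
  imports "HOL-Homology.Homology"
begin

section \<open>Paths and the fundamental group of an abstract topological space\<close>

text \<open>The path operations of HOL-Analysis require a type of class \<^class>\<open>topological_space\<close>; here spaces
  are values of type \<^typ>\<open>'a topology\<close>. A path is a function satisfying \<^const>\<open>pathin\<close>; only its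
  restriction to the unit interval matters.\<close>

definition join_paths :: "(real \<Rightarrow> 'a) \<Rightarrow> (real \<Rightarrow> 'a) \<Rightarrow> real \<Rightarrow> 'a" where
  "join_paths g h = (\<lambda>t. if t \<le> 1/2 then g (2 * t) else h (2 * t - 1))"

definition reverse_path :: "(real \<Rightarrow> 'a) \<Rightarrow> real \<Rightarrow> 'a" where
  "reverse_path g = (\<lambda>t. g (1 - t))"

definition path_homotopic :: "'a topology \<Rightarrow> (real \<Rightarrow> 'a) \<Rightarrow> (real \<Rightarrow> 'a) \<Rightarrow> bool" where
  "path_homotopic X g h \<longleftrightarrow>
     homotopic_with (\<lambda>k. k 0 = g 0 \<and> k 1 = g 1) (top_of_set {0..1}) X g h"

definition loopin :: "'a topology \<Rightarrow> (real \<Rightarrow> 'a) \<Rightarrow> bool" where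
  "loopin X g \<longleftrightarrow> pathin X g \<and> g 0 = g 1"

primrec loop_npower :: "(real \<Rightarrow> 'a) \<Rightarrow> nat \<Rightarrow> real \<Rightarrow> 'a" where
  "loop_npower g 0 = (\<lambda>_. g 0)"
| "loop_npower g (Suc n) = join_paths (loop_npower g n) g"

definition loop_power :: "(real \<Rightarrow> 'a) \<Rightarrow> int \<Rightarrow> real \<Rightarrow> 'a" where
  "loop_power g k =
     (if 0 \<le> k then loop_npower g (nat k) else loop_npower (reverse_path g) (nat (- k)))"

text \<open>The class of the loop \<open>g\<close> generates the (cyclic) fundamental group of \<open>X\<close> at the base
  point \<open>g 0\<close>.\<close>

definition generates_fundamental_group :: "'a topology \<Rightarrow> (real \<Rightarrow> 'a) \<Rightarrow> bool" where
  "generates_fundamental_group X g \<longleftrightarrow>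
     loopin X g \<and>
     (\<forall>h. loopin X h \<and> h 0 = g 0 \<longrightarrow> (\<exists>k::int. path_homotopic X (loop_power g k) h))"

section \<open>Local systems\<close>

text \<open>A local system on \<open>X\<close> all of whose fibers are the group \<^typ>\<open>'g\<close>: to every path \<open>g\<close> from
  \<open>x\<close> to \<open>y\<close> it assigns the parallel transport from the fiber at \<open>x\<close> to the fiber at \<open>y\<close>, a group
  isomorphism depending only on the homotopy class of \<open>g\<close> relative to the end points and compatible
  with concatenation, that is, a functor on the fundamental groupoid of \<open>X\<close>.\<close>

type_synonym ('a, 'g) transport = "(real \<Rightarrow> 'a) \<Rightarrow> 'g \<Rightarrow> 'g"

definition local_system :: "'a topology \<Rightarrow> ('a, 'g::ab_group_add) transport \<Rightarrow> bool" where
  "local_system X L \<longleftrightarrow>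
     (\<forall>g. pathin X g \<longrightarrow> bij (L g) \<and> (\<forall>a b. L g (a + b) = L g a + L g b)) \<and>
     (\<forall>g h. path_homotopic X g h \<longrightarrow> L g = L h) \<and>
     (\<forall>g h. pathin X g \<and> pathin X h \<and> g 1 = h 0 \<longrightarrow> L (join_paths g h) = L h \<circ> L g)"

definition pullback_system :: "('b \<Rightarrow> 'a) \<Rightarrow> ('a, 'g) transport \<Rightarrow> ('b, 'g) transport" where
  "pullback_system f L = (\<lambda>g. L (f \<circ> g))"

text \<open>An additive endomorphism \<open>\<phi>\<close> of \<open>\<int>\<close> is multiplication by \<open>\<phi> 1\<close>. Hence under the identification
  of a tensor power of \<open>\<int>\<close> with \<open>\<int>\<close> by multiplication, a tensor product of such maps \<open>\<phi>\<^sub>i\<close> is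
  multiplication by the product of the numbers \<open>\<phi>\<^sub>i 1\<close>; and under the identification of
  \<open>\<int> \<otimes> \<rat>\<close> with \<open>\<rat>\<close>, the map \<open>\<phi> \<otimes> id\<close> is multiplication by the image of \<open>\<phi> 1\<close> in \<open>\<rat>\<close>.\<close>

definition tensor_system :: "'i set \<Rightarrow> ('i \<Rightarrow> ('a, int) transport) \<Rightarrow> ('a, int) transport" where
  "tensor_system I L = (\<lambda>g a. (\<Prod>i\<in>I. L i g 1) * a)"

definition rationalize_system :: "('a, int) transport \<Rightarrow> ('a, rat) transport" where
  "rationalize_system L = (\<lambda>g q. of_int (L g 1) * q)"

section \<open>Singular homology with coefficients in a local system\<close>

text \<open>A chain is a finite formal sum of singular simplices \<open>\<sigma>\<close> with coefficients in the fiber over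
  the image under \<open>\<sigma>\<close> of the vertex \<open>0\<close>. Among the faces of \<open>\<sigma>\<close>, only the one opposite to the vertex \<open>0\<close>
  has another initial vertex, namely the vertex \<open>1\<close> of \<open>\<sigma>\<close>; its coefficient is transported there
  along the edge from \<open>0\<close> to \<open>1\<close>.\<close>

type_synonym ('a, 'g) local_chain = "((nat \<Rightarrow> real) \<Rightarrow> 'a) \<Rightarrow>\<^sub>0 'g"

definition initial_edge :: "((nat \<Rightarrow> real) \<Rightarrow> 'a) \<Rightarrow> real \<Rightarrow> 'a" where
  "initial_edge \<sigma> = (\<lambda>t. \<sigma> (\<lambda>i. if i = 0 then 1 - t else if i = 1 then t else 0))"

definition local_boundary ::
    "('a, 'g::ab_group_add) transport \<Rightarrow> nat \<Rightarrow> ('a, 'g) local_chain \<Rightarrow> ('a, 'g) local_chain" where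
  "local_boundary L p c =
     (if p = 0 then 0
      else \<Sum>\<sigma>\<in>Poly_Mapping.keys c.
             Poly_Mapping.single (singular_face p 0 \<sigma>)
               (L (initial_edge \<sigma>) (Poly_Mapping.lookup c \<sigma>)) +
             (\<Sum>k=1..p. Poly_Mapping.single (singular_face p k \<sigma>)
               ((uminus ^^ k) (Poly_Mapping.lookup c \<sigma>))))"

definition local_chains :: "'a topology \<Rightarrow> nat \<Rightarrow> ('a, 'g::zero) local_chain set" where
  "local_chains X p = {c. Poly_Mapping.keys c \<subseteq> singular_simplex_set p X}"

definition local_cycle_group ::
    "'a topology \<Rightarrow> ('a, 'g::ab_group_add) transport \<Rightarrow> nat \<Rightarrow> ('a, 'g) local_chain monoid" where
  "local_cycle_group X L p =
     \<lparr>carrier = {c \<in> local_chains X p. local_boundary L p c = 0}, monoid.mult = (+), one = 0\<rparr>"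

definition local_homology_group ::
    "'a topology \<Rightarrow> ('a, 'g::ab_group_add) transport \<Rightarrow> nat \<Rightarrow> ('a, 'g) local_chain set monoid" where
  "local_homology_group X L p =
     local_cycle_group X L p Mod (local_boundary L (Suc p) ` local_chains X (Suc p))"

section \<open>Real projective spaces and configuration spaces\<close>

definition antipodal_pair :: "(nat \<Rightarrow> real) \<Rightarrow> (nat \<Rightarrow> real) set" where
  "antipodal_pair x = {x, \<lambda>i. - x i}"

text \<open>The quotient of the unit sphere in \<open>\<real>\<^sup>m\<^sup>+\<^sup>1\<close> by the antipodal map; see \<open>quotient_map_RP\<close>.\<close>

definition RP :: "nat \<Rightarrow> (nat \<Rightarrow> real) set topology" where
  "RP m = topology (\<lambda>U. U \<subseteq> antipodal_pair ` topspace (nsphere m) \<and>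
             openin (nsphere m) {x \<in> topspace (nsphere m). antipodal_pair x \<in> U})"

lemma openin_RP:
  "openin (RP m) U \<longleftrightarrow> U \<subseteq> antipodal_pair ` topspace (nsphere m) \<and>
     openin (nsphere m) {x \<in> topspace (nsphere m). antipodal_pair x \<in> U}"
proof -
  let ?P = "\<lambda>U. U \<subseteq> antipodal_pair ` topspace (nsphere m) \<and>
     openin (nsphere m) {x \<in> topspace (nsphere m). antipodal_pair x \<in> U}"
  have "istopology ?P"
    unfolding istopology_def
  proof (intro conjI allI impI)
    fix S T assume ST: "?P S" "?P T"
    have "{x \<in> topspace (nsphere m). antipodal_pair x \<in> S \<inter> T} =
        {x \<in> topspace (nsphere m). antipodal_pair x \<in> S} \<inter>
        {x \<in> topspace (nsphere m). antipodal_pair x \<in> T}" by blast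
    with ST show "openin (nsphere m) {x \<in> topspace (nsphere m). antipodal_pair x \<in> S \<inter> T}"
      by auto
    show "S \<inter> T \<subseteq> antipodal_pair ` topspace (nsphere m)"
      using ST by blast
  next
    fix K assume K: "\<forall>S\<in>K. ?P S"
    have "{x \<in> topspace (nsphere m). antipodal_pair x \<in> \<Union>K} =
        (\<Union>S\<in>K. {x \<in> topspace (nsphere m). antipodal_pair x \<in> S})" by blast
    with K show "openin (nsphere m) {x \<in> topspace (nsphere m). antipodal_pair x \<in> \<Union>K}"
      by auto
    show "\<Union>K \<subseteq> antipodal_pair ` topspace (nsphere m)"
      using K by blast
  qed
  then show ?thesis
    by (simp add: RP_def)
qed

lemma topspace_RP: "topspace (RP m) = antipodal_pair ` topspace (nsphere m)"
proof
  show "topspace (RP m) \<subseteq> antipodal_pair ` topspace (nsphere m)"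
    using openin_RP openin_topspace by blast
  have "{x \<in> topspace (nsphere m). antipodal_pair x \<in> antipodal_pair ` topspace (nsphere m)} =
      topspace (nsphere m)" by blast
  then have "openin (RP m) (antipodal_pair ` topspace (nsphere m))"
    by (simp add: openin_RP)
  then show "antipodal_pair ` topspace (nsphere m) \<subseteq> topspace (RP m)"
    by (rule openin_subset)
qed

lemma quotient_map_RP: "quotient_map (nsphere m) (RP m) antipodal_pair"
  by (auto simp: quotient_map_def openin_RP topspace_RP)

definition configuration_space :: "'a topology \<Rightarrow> nat \<Rightarrow> (nat \<Rightarrow> 'a) topology" where
  "configuration_space X N =
     subtopology (product_topology (\<lambda>_. X) {..<N}) {c. inj_on c {..<N}}"

text \<open>The \<open>N\<close>-fold external tensor power of \<open>L\<close>, the tensor product of the pullbacks of \<open>L\<close> along the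
  \<open>N\<close> projections. It is a local system on the \<open>N\<close>-th power of the base space; since paths in a subspace
  are paths in the whole space, its restriction to a subspace is given by the same transport.\<close>

definition external_tensor_power :: "nat \<Rightarrow> ('a, int) transport \<Rightarrow> (nat \<Rightarrow> 'a, int) transport" where
  "external_tensor_power N L = tensor_system {..<N} (\<lambda>i. pullback_system (\<lambda>c. c i) L)"

end

theory Submission
  imports Defs "HOL-Analysis.Abstract_Topological_Spaces"
begin

text \<open>For odd \<open>m\<close> the sphere of dimension \<open>m\<close> is the unit sphere of a complex vector space, so the
  circle acts on it by scalar multiplication. The scalar \<open>-1\<close> acts trivially on projective space, hence
  the half turns \<open>exp (\<i> \<pi> t)\<close>, \<open>0 \<le> t \<le> 1\<close>, form a homotopy from the identity of projective space to
  itself. The track of each point under this homotopy lifts to a path between antipodal points of the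
  sphere, and the given local system has monodromy \<open>-1\<close> along it
  (\<open>transport_loop_with_open_lift\<close>). Applied to all points of a configuration at once, the half turns
  give a homotopy from the identity of the configuration space to itself along whose tracks the
  tensor product system has monodromy \<open>(-1)\<^sup>N = -1\<close>
  (\<open>inverting_homotopy_rotate_configuration\<close>).

  Homotopy invariance of homology with local coefficients identifies the two ends of a homotopy up to
  the transport along its tracks. Here it says that each homology class equals its own
  negative. In terms of chains, the prism operator \<open>P\<close> of the homotopy satisfies
  \<open>\<partial> P + P \<partial> = - 2\<close> (\<open>boundary_prism_operator\<close>); hence twice a cycle is a boundary,
  and with rational coefficients every cycle is one.

  The topological point is that the monodromy along the tracks is determined by the hypothesis on one
  generator of the fundamental group. This rests on the double covering of projective
  space by the sphere: whether the lift of a loop closes up is a homotopy invariant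
  (\<open>lifts_of_homotopic_paths_end_together\<close>) and multiplicative, so it can be compared with the
  parity of the exponent in a power of the generator.\<close>

section \<open>Additive extension from simplices to chains\<close>

text \<open>Chains are a direct sum of copies of the coefficient group, one for each simplex, so an additive
  map on chains is the same as a family of additive maps on coefficients. The boundary and the prism
  operator are both of this form.\<close>

definition additive_extension :: "('a \<Rightarrow> 'g \<Rightarrow> 'c) \<Rightarrow> ('a \<Rightarrow>\<^sub>0 'g::ab_group_add) \<Rightarrow> 'c::ab_group_add" where
  "additive_extension f c = (\<Sum>k\<in>Poly_Mapping.keys c. f k (Poly_Mapping.lookup c k))"

lemma additive_extension_add:
  assumes "\<And>k. Modules.additive (f k)"
  shows "additive_extension f (c + d) = additive_extension f c + additive_extension f d"
  unfolding additive_extension_def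
  by (rule setsum_keys_plus_distrib) (auto simp: assms additive.zero additive.add)

lemma additive_additive_extension:
  assumes "\<And>k. Modules.additive (f k)"
  shows "Modules.additive (additive_extension f)"
  using additive_extension_add[of f] assms by unfold_locales blast

lemma additive_extension_single:
  assumes "Modules.additive (f k)"
  shows "additive_extension f (Poly_Mapping.single k a) = f k a"
  by (simp add: additive_extension_def additive.zero[OF assms])

text \<open>The coefficients are only assumed to form an abelian group, so the sign \<open>(-1)\<^sup>k\<close> appears as the
  \<open>k\<close>-fold iterate of negation.\<close>

lemma additive_alternating: "Modules.additive ((uminus ^^ k) :: 'g::ab_group_add \<Rightarrow> 'g)"
  by (unfold_locales, induction k) auto

lemma additive_alternating_commute:
  assumes "Modules.additive f"
  shows "f ((uminus ^^ k) a) = (uminus ^^ k) (f (a :: 'g::ab_group_add))"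
  by (induction k) (simp_all add: additive.minus[OF assms])

lemma alternating_add: "(uminus ^^ (j + k)) a = (uminus ^^ j) ((uminus ^^ k) a)"
  by (simp add: funpow_add)

lemma alternating_single:
  "(uminus ^^ k) (Poly_Mapping.single s a) = Poly_Mapping.single s ((uminus ^^ k) (a::'g::ab_group_add))"
  by (induction k) (auto simp: single_uminus)

lemma additive_single: "Modules.additive (Poly_Mapping.single s)"
  by unfold_locales (simp add: single_add)

lemma additive_comp: "Modules.additive f \<Longrightarrow> Modules.additive g \<Longrightarrow> Modules.additive (\<lambda>a. f (g a))"
  by (simp add: additive_def)

lemma additive_sum: "(\<And>i. i \<in> I \<Longrightarrow> Modules.additive (f i)) \<Longrightarrow>
    Modules.additive (\<lambda>a. \<Sum>i\<in>I. f i a :: 'g::ab_group_add)"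
  by (simp add: additive_def sum.distrib)

definition face_coefficient ::
    "('a, 'g::ab_group_add) transport \<Rightarrow> ((nat \<Rightarrow> real) \<Rightarrow> 'a) \<Rightarrow> nat \<Rightarrow> 'g \<Rightarrow> 'g" where
  "face_coefficient L \<sigma> k a = (if k = 0 then L (initial_edge \<sigma>) a else a)"

text \<open>The face opposite to the vertex \<open>0\<close> is treated on a par with the other faces, its transport being
  hidden in the coefficient; the cancellations in the boundary of a prism then follow one pattern.\<close>

definition simplex_boundary ::
    "('a, 'g::ab_group_add) transport \<Rightarrow> nat \<Rightarrow> ((nat \<Rightarrow> real) \<Rightarrow> 'a) \<Rightarrow> 'g \<Rightarrow> ('a, 'g) local_chain" where
  "simplex_boundary L p \<sigma> a =
     (if p = 0 then 0
      else \<Sum>k\<le>p. (uminus ^^ k) (Poly_Mapping.single (singular_face p k \<sigma>) (face_coefficient L \<sigma> k a)))"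

lemma local_boundary_eq_additive_extension:
  fixes L :: "('a, 'g::ab_group_add) transport"
  shows "local_boundary L p = additive_extension (simplex_boundary L p)"
proof
  fix c :: "('a, 'g) local_chain"
  have "{..p} = insert 0 {1..p}" if "p > 0" by auto
  then have "simplex_boundary L p \<sigma> a =
     (Poly_Mapping.single (singular_face p 0 \<sigma>) (L (initial_edge \<sigma>) a) +
             (\<Sum>k=1..p. Poly_Mapping.single (singular_face p k \<sigma>) ((uminus ^^ k) a)) :: ('a, 'g) local_chain)"
    if "p > 0" for \<sigma> and a :: 'g
    using that by (simp add: simplex_boundary_def face_coefficient_def alternating_single)
  then show "local_boundary L p c = additive_extension (simplex_boundary L p) c"
    by (cases "p = 0") (simp_all add: local_boundary_def additive_extension_def simplex_boundary_def)
qed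

lemma additive_simplex_boundary:
  assumes "\<And>g. Modules.additive (L g)"
  shows "Modules.additive (simplex_boundary L p \<sigma>)"
proof -
  have "Modules.additive (\<lambda>a. (uminus ^^ k) (Poly_Mapping.single (singular_face p k \<sigma>) (face_coefficient L \<sigma> k a)))"
    for k
    using assms by (intro additive_comp[OF additive_alternating] additive_comp[OF additive_single])
      (auto simp: face_coefficient_def additive_def)
  then show ?thesis
    unfolding simplex_boundary_def by (cases "p = 0") (auto simp: additive_def sum.distrib)
qed

lemma additive_local_boundary:
  assumes "\<And>g. Modules.additive (L g)"
  shows "Modules.additive (local_boundary L p)"
  unfolding local_boundary_eq_additive_extension
  by (intro additive_additive_extension additive_simplex_boundary assms)

section \<open>The prism over a singular simplex\<close>

text \<open>The simplicial degeneracy: the affine map that sends the vertices \<open>i\<close> and \<open>i + 1\<close> to the vertex \<open>i\<close>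
  and preserves the order of the vertices.\<close>

definition merge_vertices :: "nat \<Rightarrow> (nat \<Rightarrow> real) \<Rightarrow> nat \<Rightarrow> real" where
  "merge_vertices i x = (\<lambda>j. if j < i then x j else if j = i then x i + x (Suc i) else x (Suc j))"

text \<open>Let \<open>v\<^sub>j\<close> and \<open>w\<^sub>j\<close> be the vertices of the bottom (time \<open>0\<close>) and of the top (time \<open>1\<close>) of the prism over
  the standard simplex. The piece with index \<open>i\<close> of its standard triangulation has the vertices
  \<open>v\<^sub>0, \<dots>, v\<^sub>i, w\<^sub>i, \<dots>, w\<^sub>p\<close>. Its time coordinate is therefore the sum of the barycentric coordinates
  beyond the index \<open>i\<close>, that is \<open>1\<close> minus the sum of the first \<open>i + 1\<close> of them, a formula in which the
  dimension does not occur. All pieces start at \<open>v\<^sub>0\<close>, which is why the prism operator can keep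
  the coefficients as they are.\<close>

definition prism_simplex ::
    "(real \<times> 'a \<Rightarrow> 'a) \<Rightarrow> nat \<Rightarrow> nat \<Rightarrow> ((nat \<Rightarrow> real) \<Rightarrow> 'a) \<Rightarrow> (nat \<Rightarrow> real) \<Rightarrow> 'a" where
  "prism_simplex H p i \<sigma> =
     restrict (\<lambda>x. H (1 - (\<Sum>j<Suc i. x j), \<sigma> (merge_vertices i x))) (standard_simplex (Suc p))"

text \<open>The simplex with the vertices \<open>v\<^sub>0, \<dots>, v\<^bsub>i-1\<^esub>, w\<^sub>i, \<dots>, w\<^sub>p\<close>. It is the common face of two consecutive pieces of
  the prism; it is the whole top for \<open>i = 0\<close> and the whole bottom for \<open>i = p + 1\<close>.\<close>

definition prism_cross_section ::
    "(real \<times> 'a \<Rightarrow> 'a) \<Rightarrow> nat \<Rightarrow> nat \<Rightarrow> ((nat \<Rightarrow> real) \<Rightarrow> 'a) \<Rightarrow> (nat \<Rightarrow> real) \<Rightarrow> 'a" where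
  "prism_cross_section H p i \<sigma> =
     restrict (\<lambda>x. H (1 - (\<Sum>j<i. x j), \<sigma> x)) (standard_simplex p)"

lemma sum_simplical_face:
  fixes x :: "nat \<Rightarrow> real"
  shows "(\<Sum>j<n. simplical_face k x j) = (if k < n then \<Sum>j<n - 1. x j else \<Sum>j<n. x j)"
proof (induction n)
  case (Suc n)
  show ?case
    by (cases n) (use Suc in \<open>auto simp: simplical_face_def not_less less_Suc_eq\<close>)
qed simp

lemma sum_merge_vertices:
  "(\<Sum>j<n. merge_vertices i x j) = (if i < n then \<Sum>j<Suc n. x j else \<Sum>j<n. x j)"
  by (induction n) (auto simp: merge_vertices_def not_less less_Suc_eq)

lemma merge_vertices_in_standard_simplex:
  assumes "x \<in> standard_simplex (Suc p)" "i \<le> p"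
  shows "merge_vertices i x \<in> standard_simplex p"
proof -
  have nonneg: "0 \<le> merge_vertices i x j" for j
    using assms by (auto simp: merge_vertices_def standard_simplex_def)
  have zero: "merge_vertices i x j = 0" if "j > p" for j
    using assms that by (auto simp: merge_vertices_def standard_simplex_def)
  have total: "(\<Sum>j\<le>p. merge_vertices i x j) = 1"
    using sum_merge_vertices[of i x "Suc p"] assms
    by (simp add: standard_simplex_def lessThan_Suc_atMost)
  have "merge_vertices i x j \<le> 1" for j
    using member_le_sum[of j "{..p}" "merge_vertices i x"] nonneg total zero[of j]
    by (cases "j \<le> p") auto
  then show ?thesis
    using nonneg zero total by (simp add: standard_simplex_def)
qed

lemma partial_sum_standard_simplex:
  assumes "x \<in> standard_simplex p"
  shows "(\<Sum>j<n. x j) \<in> {0..1}"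
proof -
  have "(\<Sum>j<n. x j) = (\<Sum>j\<in>{..<n} \<inter> {..p}. x j)"
    using assms by (intro sum.mono_neutral_right) (auto simp: standard_simplex_def not_le[symmetric])
  also have "\<dots> \<le> (\<Sum>j\<le>p. x j)"
    using assms by (intro sum_mono2) (auto simp: standard_simplex_def)
  finally show ?thesis
    using assms by (auto simp: standard_simplex_def intro!: sum_nonneg)
qed

lemma merge_vertices_simplical_face:
  "k < i \<Longrightarrow> merge_vertices i (simplical_face k x) = simplical_face k (merge_vertices (i - 1) x)"
  "Suc i < k \<Longrightarrow> merge_vertices i (simplical_face k x) = simplical_face (k - 1) (merge_vertices i x)"
  "merge_vertices i (simplical_face i x) = x"
  "merge_vertices i (simplical_face (Suc i) x) = x"
  by (auto simp: merge_vertices_def simplical_face_def fun_eq_iff)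

text \<open>A face of a piece either is a piece of the prism over a face, when a vertex other than the two
  over \<open>i\<close> is omitted, or is one of the two cross sections that separate the piece from its neighbours.\<close>

lemma singular_face_prism_simplex:
  assumes "i \<le> p" "k \<le> Suc p"
  shows "k < i \<Longrightarrow> singular_face (Suc p) k (prism_simplex H p i \<sigma>) =
           prism_simplex H (p - 1) (i - 1) (singular_face p k \<sigma>)"
    and "Suc i < k \<Longrightarrow> singular_face (Suc p) k (prism_simplex H p i \<sigma>) =
           prism_simplex H (p - 1) i (singular_face p (k - 1) \<sigma>)"
    and "k = i \<Longrightarrow> singular_face (Suc p) k (prism_simplex H p i \<sigma>) = prism_cross_section H p i \<sigma>"
    and "k = Suc i \<Longrightarrow>
           singular_face (Suc p) k (prism_simplex H p i \<sigma>) = prism_cross_section H p (Suc i) \<sigma>"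
proof -
  have face: "simplical_face j x \<in> standard_simplex (Suc p)" if "x \<in> standard_simplex p" "j \<le> Suc p" for x j
    using simplical_face_in_standard_simplex[of "Suc p" j x] that by simp
  have merge: "merge_vertices j x \<in> standard_simplex (p - Suc 0)"
    if "x \<in> standard_simplex p" "j \<le> p - 1" "0 < p" for j x
    using merge_vertices_in_standard_simplex[of x "p - 1" j] that by simp
  show "singular_face (Suc p) k (prism_simplex H p i \<sigma>) =
      prism_simplex H (p - 1) (i - 1) (singular_face p k \<sigma>)" if "k < i"
    using that assms
    by (auto simp: singular_face_def prism_simplex_def fun_eq_iff face merge sum_simplical_face
        merge_vertices_simplical_face simp del: sum.lessThan_Suc)
  show "singular_face (Suc p) k (prism_simplex H p i \<sigma>) =
      prism_simplex H (p - 1) i (singular_face p (k - 1) \<sigma>)" if "Suc i < k"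
    using that assms
    by (auto simp: singular_face_def prism_simplex_def fun_eq_iff face merge sum_simplical_face
        merge_vertices_simplical_face simp del: sum.lessThan_Suc)
  show "singular_face (Suc p) k (prism_simplex H p i \<sigma>) = prism_cross_section H p i \<sigma>" if "k = i"
    using that assms
    by (auto simp: singular_face_def prism_simplex_def prism_cross_section_def fun_eq_iff face
        sum_simplical_face merge_vertices_simplical_face simp del: sum.lessThan_Suc)
  show "singular_face (Suc p) k (prism_simplex H p i \<sigma>) = prism_cross_section H p (Suc i) \<sigma>"
    if "k = Suc i"
    using that assms
    by (auto simp: singular_face_def prism_simplex_def prism_cross_section_def fun_eq_iff face
        sum_simplical_face merge_vertices_simplical_face simp del: sum.lessThan_Suc)
qed

lemma continuous_map_partial_sum:
  "continuous_map (subtopology (powertop_real UNIV) S) euclideanreal (\<lambda>x. \<Sum>j<n::nat. x j)"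
  by (intro continuous_map_from_subtopology continuous_map_sum continuous_map_product_projection)
    auto

lemma continuous_map_merge_vertices:
  assumes "i \<le> p"
  shows "continuous_map (subtopology (powertop_real UNIV) (standard_simplex (Suc p)))
           (subtopology (powertop_real UNIV) (standard_simplex p)) (merge_vertices i)"
proof -
  have "continuous_map (powertop_real UNIV) euclideanreal (\<lambda>x. merge_vertices i x j)" for j
    by (cases "j < i"; cases "j = i") (auto simp: merge_vertices_def intro!: continuous_intros)
  then show ?thesis
    using merge_vertices_in_standard_simplex[OF _ assms]
    by (auto simp: continuous_map_in_subtopology continuous_map_componentwise_UNIV
        continuous_map_from_subtopology)
qed

lemma singular_simplex_prism_simplex:
  assumes H: "continuous_map (prod_topology (top_of_set {0..1}) X) X H"
    and \<sigma>: "singular_simplex p X \<sigma>" and "i \<le> p"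
  shows "singular_simplex (Suc p) X (prism_simplex H p i \<sigma>)"
proof -
  let ?S = "\<lambda>p. subtopology (powertop_real UNIV) (standard_simplex p)"
  have "continuous_map (?S (Suc p)) (top_of_set {0..1}) (\<lambda>x. 1 - (\<Sum>j<Suc i. x j))"
    using partial_sum_standard_simplex[of _ "Suc p" "Suc i"] 
    by (auto simp: continuous_map_in_subtopology simp del: sum.lessThan_Suc
        intro!: continuous_map_diff continuous_map_partial_sum)
  moreover have "continuous_map (?S (Suc p)) X (\<lambda>x. \<sigma> (merge_vertices i x))"
    using continuous_map_compose[OF continuous_map_merge_vertices[OF \<open>i \<le> p\<close>], of X \<sigma>] \<sigma>
    by (simp add: singular_simplex_def o_def)
  ultimately have "continuous_map (?S (Suc p)) (prod_topology (top_of_set {0..1}) X)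
      (\<lambda>x. (1 - (\<Sum>j<Suc i. x j), \<sigma> (merge_vertices i x)))"
    by (simp add: continuous_map_pairwise o_def)
  from continuous_map_compose[OF this H]
  have "continuous_map (?S (Suc p)) X (\<lambda>x. H (1 - (\<Sum>j<Suc i. x j), \<sigma> (merge_vertices i x)))"
    by (simp add: o_def)
  then show ?thesis
    unfolding singular_simplex_def prism_simplex_def
    by (auto elim!: continuous_map_eq)
qed

definition prism_operator ::
    "(real \<times> 'a \<Rightarrow> 'a) \<Rightarrow> nat \<Rightarrow> ((nat \<Rightarrow> real) \<Rightarrow> 'a) \<Rightarrow> 'g::ab_group_add \<Rightarrow> ('a, 'g) local_chain" where
  "prism_operator H p \<sigma> a = (\<Sum>i\<le>p. (uminus ^^ i) (Poly_Mapping.single (prism_simplex H p i \<sigma>) a))"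

lemma additive_prism_operator: "Modules.additive (prism_operator H p \<sigma>)"
  unfolding prism_operator_def
  by (intro additive_sum additive_comp[OF additive_alternating] additive_single)

lemma keys_alternating: "Poly_Mapping.keys ((uminus ^^ k) (c :: 'a \<Rightarrow>\<^sub>0 'g::ab_group_add)) = Poly_Mapping.keys c"
  by (induction k) (auto simp: in_keys_iff)

lemma keys_prism_operator: "Poly_Mapping.keys (prism_operator H p \<sigma> a) \<subseteq> (\<lambda>i. prism_simplex H p i \<sigma>) ` {..p}"
  unfolding prism_operator_def
  by (rule order_trans[OF Poly_Mapping.keys_sum]) (auto simp: keys_alternating split: if_splits)

text \<open>The sign bookkeeping for the boundary of a prism: the cross sections \<open>e\<close> telescope, and the
  remaining faces make up the prism over the boundary. The entry \<open>F 0 0\<close> is kept as it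
  is, since it stands for the top of the prism, whose coefficient has been transported.\<close>

lemma prism_double_sum:
  fixes F G :: "nat \<Rightarrow> nat \<Rightarrow> 'c::ab_group_add" and e :: "nat \<Rightarrow> 'c"
  assumes low: "\<And>i k. i \<le> p \<Longrightarrow> k < i \<Longrightarrow> F i k = - G (i - 1) k"
    and high: "\<And>i k. k \<le> Suc p \<Longrightarrow> Suc i < k \<Longrightarrow> F i k = - G i (k - 1)"
    and diag: "\<And>i. 0 < i \<Longrightarrow> i \<le> p \<Longrightarrow> F i i = e i"
    and super: "\<And>i. i \<le> p \<Longrightarrow> F i (Suc i) = - e (Suc i)"
  shows "(\<Sum>i\<le>p. \<Sum>k\<le>Suc p. F i k) = F 0 0 - e (Suc p) - (\<Sum>i<p. \<Sum>k\<le>p. G i k)"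
proof -
  have "(\<Sum>k\<le>Suc p. F i k) = (\<Sum>k<i. F i k) + F i i + F i (Suc i) + (\<Sum>k\<in>{Suc i<..Suc p}. F i k)"
    if "i \<le> p" for i
  proof -
    have "{..Suc p} = ({..<i} \<union> {i, Suc i}) \<union> {Suc i<..Suc p}" using that by auto
    then show ?thesis
      by (simp add: sum.union_disjoint disjoint_iff algebra_simps)
  qed
  then have "(\<Sum>i\<le>p. \<Sum>k\<le>Suc p. F i k) =
      (\<Sum>i\<le>p. \<Sum>k<i. F i k) + (\<Sum>i\<le>p. F i i + F i (Suc i)) + (\<Sum>i\<le>p. \<Sum>k\<in>{Suc i<..Suc p}. F i k)"
    by (simp add: sum.distrib algebra_simps)
  moreover have "(\<Sum>i\<le>p. F i i + F i (Suc i)) = F 0 0 - e (Suc p)"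
  proof -
    have "(\<Sum>i\<le>q. F i i + F i (Suc i)) = F 0 0 - e (Suc q)" if "q \<le> p" for q
      using that by (induction q) (auto simp: diag super)
    then show ?thesis by simp
  qed
  moreover have "(\<Sum>i\<le>p. \<Sum>k<i. F i k) = - (\<Sum>i<p. \<Sum>k\<le>i. G i k)"
  proof -
    have "(\<Sum>i\<le>p. \<Sum>k<i. F i k) = (\<Sum>i<p. \<Sum>k<Suc i. F (Suc i) k)"
      using sum.atMost_shift[of "\<lambda>i. \<Sum>k<i. F i k" p] by simp
    also have "\<dots> = (\<Sum>i<p. \<Sum>k\<le>i. - G i k)"
      by (intro sum.cong) (auto simp: low lessThan_Suc_atMost)
    finally show ?thesis by (simp add: sum_negf)
  qed
  moreover have "(\<Sum>i\<le>p. \<Sum>k\<in>{Suc i<..Suc p}. F i k) = - (\<Sum>i<p. \<Sum>k\<in>{i<..p}. G i k)"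
  proof -
    have "(\<Sum>k\<in>{Suc i<..Suc p}. F i k) = (\<Sum>k\<in>{i<..p}. - G i k)" for i
      by (rule sum.reindex_bij_witness[of _ Suc "\<lambda>k. k - 1"]) (auto simp: high)
    then show ?thesis
      by (simp add: sum_negf flip: lessThan_Suc_atMost)
  qed
  moreover have "(\<Sum>k\<le>p. G i k) = (\<Sum>k\<le>i. G i k) + (\<Sum>k\<in>{i<..p}. G i k)" if "i < p" for i
  proof -
    have "{..p} = {..i} \<union> {i<..p}" using that by auto
    then show ?thesis by (simp add: sum.union_disjoint disjoint_iff)
  qed
  then have "(\<Sum>i<p. \<Sum>k\<le>p. G i k) = (\<Sum>i<p. \<Sum>k\<le>i. G i k) + (\<Sum>i<p. \<Sum>k\<in>{i<..p}. G i k)"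
    by (simp add: sum.distrib)
  ultimately show ?thesis by (simp add: algebra_simps)
qed

definition edge_point :: "real \<Rightarrow> nat \<Rightarrow> real" where
  "edge_point t = (\<lambda>i. if i = 0 then 1 - t else if i = 1 then t else 0)"

lemma initial_edge_edge_point: "initial_edge \<sigma> t = \<sigma> (edge_point t)"
  by (simp add: initial_edge_def edge_point_def)

lemma edge_point_in_standard_simplex:
  assumes "t \<in> {0..1}"
  shows "edge_point t \<in> standard_simplex (Suc p)"
proof -
  have "{..Suc p} = insert 0 (insert (Suc 0) {2..Suc p})" by auto
  then show ?thesis
    using assms by (auto simp: standard_simplex_def edge_point_def)
qed

lemma sum_edge_point: "(\<Sum>j<n. edge_point t j) = (if n = 0 then 0 else if n = 1 then 1 - t else 1)"
  by (induction n) (auto simp: edge_point_def)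

lemma pathin_initial_edge:
  assumes "singular_simplex (Suc p) X \<sigma>"
  shows "pathin X (initial_edge \<sigma>)"
proof -
  have "continuous_map (top_of_set {0..1::real}) euclideanreal (\<lambda>t. edge_point t j)" for j
    by (cases "j = 0"; cases "j = 1") (auto simp: edge_point_def intro!: continuous_intros)
  then have "continuous_map (top_of_set {0..1})
      (subtopology (powertop_real UNIV) (standard_simplex (Suc p))) edge_point"
    using edge_point_in_standard_simplex
    by (auto simp: continuous_map_in_subtopology continuous_map_componentwise_UNIV)
  from continuous_map_compose[OF this] show ?thesis
    using assms by (auto simp: pathin_def singular_simplex_def o_def initial_edge_edge_point[abs_def])
qed

lemma initial_edge_prism_simplex:
  assumes "t \<in> {0..1}"
  shows "0 < i \<Longrightarrow> initial_edge (prism_simplex H p i \<sigma>) t = H (0, initial_edge \<sigma> t)"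
    and "initial_edge (prism_simplex H p 0 \<sigma>) t = H (t, \<sigma> (edge_point 0))"
proof -
  have "merge_vertices i (edge_point t) = edge_point t" if "0 < i"
    using that by (auto simp: merge_vertices_def edge_point_def fun_eq_iff)
  then show "initial_edge (prism_simplex H p i \<sigma>) t = H (0, initial_edge \<sigma> t)" if "0 < i"
    using that edge_point_in_standard_simplex[OF assms]
    by (simp add: initial_edge_edge_point prism_simplex_def sum_edge_point del: sum.lessThan_Suc)
  have "merge_vertices 0 (edge_point t) = edge_point 0"
    by (auto simp: merge_vertices_def edge_point_def fun_eq_iff)
  then show "initial_edge (prism_simplex H p 0 \<sigma>) t = H (t, \<sigma> (edge_point 0))"
    using edge_point_in_standard_simplex[OF assms]
    by (simp add: initial_edge_edge_point prism_simplex_def sum_edge_point del: sum.lessThan_Suc)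
qed

section \<open>Homotopies that reverse the local system\<close>

text \<open>The homotopy deforms the identity map into itself, but transport along the track of each point is
  multiplication by \<open>-1\<close>. On homology it therefore identifies the identity with its negative.\<close>

locale inverting_homotopy =
  fixes X :: "'a topology" and L :: "('a, 'g::ab_group_add) transport"
    and H :: "real \<times> 'a \<Rightarrow> 'a"
  assumes additive_transport: "\<And>g. Modules.additive (L g)"
    and transport_cong: "\<And>g h. pathin X g \<Longrightarrow> pathin X h \<Longrightarrow> (\<And>t. t \<in> {0..1} \<Longrightarrow> g t = h t) \<Longrightarrow> L g = L h"
    and continuous_homotopy: "continuous_map (prod_topology (top_of_set {0..1}) X) X H"
    and homotopy_0: "\<And>x. x \<in> topspace X \<Longrightarrow> H (0, x) = x"
    and homotopy_1: "\<And>x. x \<in> topspace X \<Longrightarrow> H (1, x) = x"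
    and transport_trajectory: "\<And>x a. x \<in> topspace X \<Longrightarrow> L (\<lambda>t. H (t, x)) a = - a"
begin

lemma prism_cross_section_ends:
  assumes "singular_simplex p X \<sigma>"
  shows "prism_cross_section H p 0 \<sigma> = \<sigma>" "prism_cross_section H p (Suc p) \<sigma> = \<sigma>"
proof -
  have \<sigma>: "\<sigma> x \<in> topspace X" if "x \<in> standard_simplex p" for x
    using assms that by (auto simp: singular_simplex_def continuous_map_def)
  have "\<sigma> \<in> extensional (standard_simplex p)"
    using assms by (simp add: singular_simplex_def)
  moreover have "(\<Sum>j<Suc p. x j) = 1" if "x \<in> standard_simplex p" for x
    using that by (simp only: lessThan_Suc_atMost) (simp add: standard_simplex_def)
  ultimately show "prism_cross_section H p 0 \<sigma> = \<sigma>" "prism_cross_section H p (Suc p) \<sigma> = \<sigma>"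
    by (auto simp: prism_cross_section_def fun_eq_iff homotopy_0 homotopy_1 \<sigma> extensional_def
        simp del: sum.lessThan_Suc)
qed

text \<open>The piece with index \<open>0\<close> begins with the vertical edge from \<open>v\<^sub>0\<close> to \<open>w\<^sub>0\<close>, which is the track of a point;
  all other pieces begin with the initial edge of the original simplex.\<close>

lemma face_coefficient_prism_simplex:
  assumes \<sigma>: "singular_simplex p X \<sigma>" and "i \<le> p"
  shows "face_coefficient L (prism_simplex H p i \<sigma>) k a =
           (if i = 0 \<and> k = 0 then - a else if i = 0 then a else face_coefficient L \<sigma> k a)"
proof -
  have path: "pathin X (initial_edge (prism_simplex H p i \<sigma>))"
    by (rule pathin_initial_edge[OF singular_simplex_prism_simplex[OF continuous_homotopy assms]])
  have vertex: "\<sigma> (edge_point 0) \<in> topspace X"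
  proof -
    have "edge_point 0 = (\<lambda>j. if j = 0 then 1 else 0)" by (auto simp: edge_point_def)
    then have "edge_point 0 \<in> standard_simplex p" by simp
    then show ?thesis using \<sigma> by (auto simp: singular_simplex_def continuous_map_def)
  qed
  have "L (initial_edge (prism_simplex H p 0 \<sigma>)) a = - a" if "i = 0"
  proof -
    have "pathin X (\<lambda>t. H (t, \<sigma> (edge_point 0)))"
      using path that continuous_map_eq[of "top_of_set {0..1}" X "initial_edge (prism_simplex H p i \<sigma>)"]
      by (simp add: pathin_def initial_edge_prism_simplex)
    then have "L (initial_edge (prism_simplex H p 0 \<sigma>)) = L (\<lambda>t. H (t, \<sigma> (edge_point 0)))"
      using path that by (intro transport_cong) (auto simp: initial_edge_prism_simplex)
    then show ?thesis by (simp add: transport_trajectory vertex)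
  qed
  moreover have "L (initial_edge (prism_simplex H p i \<sigma>)) = L (initial_edge \<sigma>)" if "0 < i"
  proof (rule transport_cong[OF path])
    show edge: "pathin X (initial_edge \<sigma>)"
      using \<sigma> \<open>0 < i\<close> \<open>i \<le> p\<close> by (cases p) (auto intro: pathin_initial_edge)
    fix t :: real assume "t \<in> {0..1}"
    then show "initial_edge (prism_simplex H p i \<sigma>) t = initial_edge \<sigma> t"
      using edge that path_image_subset_topspace[OF edge]
      by (auto simp: initial_edge_prism_simplex intro!: homotopy_0)
  qed
  ultimately show ?thesis by (auto simp: face_coefficient_def)
qed

text \<open>The chain homotopy formula. Both ends of the prism are the original simplex; the bottom comes
  with the sign \<open>-1\<close> of its face, the top with the sign \<open>-1\<close> of the transport along the track.\<close>

lemma boundary_prism_operator: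
  assumes \<sigma>: "singular_simplex p X \<sigma>"
  shows "local_boundary L (Suc p) (prism_operator H p \<sigma> a) =
    - (Poly_Mapping.single \<sigma> a + Poly_Mapping.single \<sigma> a) -
    additive_extension (prism_operator H (p - 1)) (simplex_boundary L p \<sigma> a)"
proof -
  let ?s = "Poly_Mapping.single"
  define F where "F i k = (uminus ^^ (i + k)) (?s (singular_face (Suc p) k (prism_simplex H p i \<sigma>))
      (face_coefficient L (prism_simplex H p i \<sigma>) k a))" for i k
  define G where "G i k = (uminus ^^ (i + k)) (?s (prism_simplex H (p - 1) i (singular_face p k \<sigma>))
      (face_coefficient L \<sigma> k a))" for i k
  define e where "e i = ?s (prism_cross_section H p i \<sigma>) a" for i
  have alt: "(uminus ^^ (i + i)) (c::'c::ab_group_add) = c" for i c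
    by (induction i) auto
  have boundary: "Modules.additive (local_boundary L (Suc p))"
    by (intro additive_local_boundary additive_transport)
  have "local_boundary L (Suc p) (prism_operator H p \<sigma> a) =
      (\<Sum>i\<le>p. (uminus ^^ i) (simplex_boundary L (Suc p) (prism_simplex H p i \<sigma>) a))"
    unfolding prism_operator_def additive.sum[OF boundary] additive_alternating_commute[OF boundary]
    unfolding local_boundary_eq_additive_extension
    by (simp only: additive_extension_single[OF additive_simplex_boundary[OF additive_transport]])
  also have "\<dots> = (\<Sum>i\<le>p. \<Sum>k\<le>Suc p. F i k)"
    by (simp only: simplex_boundary_def F_def alternating_add additive.sum[OF additive_alternating]
        nat.distinct if_False)
  also have "\<dots> = F 0 0 - e (Suc p) - (\<Sum>i<p. \<Sum>k\<le>p. G i k)"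
  proof (rule prism_double_sum)
    fix i k assume "i \<le> p" "k < i"
    then show "F i k = - G (i - 1) k"
      by (cases i) (auto simp: F_def G_def singular_face_prism_simplex face_coefficient_prism_simplex[OF \<sigma>])
  next
    fix i k assume "k \<le> Suc p" "Suc i < k"
    then show "F i k = - G i (k - 1)"
      by (cases k) (auto simp: F_def G_def singular_face_prism_simplex
          face_coefficient_prism_simplex[OF \<sigma>] face_coefficient_def)
  next
    fix i assume "0 < i" "i \<le> p"
    then show "F i i = e i"
      by (auto simp: F_def e_def alt singular_face_prism_simplex face_coefficient_prism_simplex[OF \<sigma>]
          face_coefficient_def simp del: funpow.simps)
  next
    fix i assume "i \<le> p"
    then show "F i (Suc i) = - e (Suc i)"
      by (auto simp: F_def e_def alt singular_face_prism_simplex face_coefficient_prism_simplex[OF \<sigma>]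
          face_coefficient_def)
  qed
  also have "F 0 0 = - ?s \<sigma> a"
    by (simp add: F_def singular_face_prism_simplex face_coefficient_prism_simplex[OF \<sigma>]
        prism_cross_section_ends[OF \<sigma>] single_uminus)
  also have "e (Suc p) = ?s \<sigma> a"
    by (simp add: e_def prism_cross_section_ends[OF \<sigma>])
  also have "(\<Sum>i<p. \<Sum>k\<le>p. G i k) = additive_extension (prism_operator H (p - 1)) (simplex_boundary L p \<sigma> a)"
  proof (cases "p = 0")
    case True
    then show ?thesis by (simp add: simplex_boundary_def additive_extension_def)
  next
    case False
    have P: "Modules.additive (additive_extension (prism_operator H (p - 1)
        :: _ \<Rightarrow> 'g \<Rightarrow> ('a, 'g) local_chain))"
      by (intro additive_additive_extension additive_prism_operator)
    have "additive_extension (prism_operator H (p - 1)) (simplex_boundary L p \<sigma> a) =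
        (\<Sum>k\<le>p. (uminus ^^ k) (prism_operator H (p - 1) (singular_face p k \<sigma>) (face_coefficient L \<sigma> k a)))"
      using False by (simp only: if_False simplex_boundary_def additive.sum[OF P]
        additive_alternating_commute[OF P] additive_extension_single[OF additive_prism_operator])
    also have "\<dots> = (\<Sum>k\<le>p. \<Sum>i\<le>p - 1. G i k)"
      unfolding prism_operator_def additive.sum[OF additive_alternating] G_def
      by (intro sum.cong refl) (metis add.commute alternating_add)
    also have "{..p - 1} = {..<p}" using False by auto
    finally show ?thesis using sum.swap by metis
  qed
  finally show ?thesis by simp
qed

lemma double_cycle_is_boundary:
  assumes c: "c \<in> local_chains X p" and cycle: "local_boundary L p c = 0"
  shows "c + c \<in> local_boundary L (Suc p) ` local_chains X (Suc p)"
proof -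
  let ?P = "\<lambda>p. additive_extension (prism_operator H p) :: ('a, 'g) local_chain \<Rightarrow> ('a, 'g) local_chain"
  interpret B: Modules.additive "local_boundary L (Suc p)"
    by (intro additive_local_boundary additive_transport)
  interpret P: Modules.additive "?P (p - 1)"
    by (intro additive_additive_extension additive_prism_operator)
  let ?K = "Poly_Mapping.keys c" and ?c = "Poly_Mapping.lookup c"
  have \<sigma>: "singular_simplex p X \<sigma>" if "\<sigma> \<in> ?K" for \<sigma>
    using c that by (auto simp: local_chains_def)
  have "c = (\<Sum>\<sigma>\<in>?K. Poly_Mapping.single \<sigma> (?c \<sigma>))"
    by (rule poly_mapping_eqI) (simp add: lookup_sum lookup_single when_def in_keys_iff)
  then have "local_boundary L (Suc p) (?P p c) =
      - (c + c) - ?P (p - 1) (\<Sum>\<sigma>\<in>?K. simplex_boundary L p \<sigma> (?c \<sigma>))"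
    by (simp add: additive_extension_def[of _ c] B.sum boundary_prism_operator \<sigma> P.sum
        sum_subtractf sum.distrib sum_negf del: One_nat_def)
  also have "(\<Sum>\<sigma>\<in>?K. simplex_boundary L p \<sigma> (?c \<sigma>)) = 0"
    using cycle by (simp add: local_boundary_eq_additive_extension additive_extension_def)
  finally have "local_boundary L (Suc p) (- ?P p c) = c + c"
    by (simp add: B.minus P.zero del: One_nat_def)
  moreover have "- ?P p c \<in> local_chains X (Suc p)"
  proof -
    have "Poly_Mapping.keys (?P p c) \<subseteq> (\<Union>\<sigma>\<in>?K. (\<lambda>i. prism_simplex H p i \<sigma>) ` {..p})"
      unfolding additive_extension_def
      by (intro order_trans[OF Poly_Mapping.keys_sum] UN_mono order_refl keys_prism_operator)
    also have "\<dots> \<subseteq> singular_simplex_set (Suc p) X"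
      using \<sigma> by (auto intro!: singular_simplex_prism_simplex continuous_homotopy)
    finally show ?thesis by (simp add: local_chains_def in_keys_iff subset_eq)
  qed
  ultimately show ?thesis by (metis imageI)
qed

end

text \<open>If every cycle is a boundary, then translating the group of boundaries by a cycle does not move it,
  so there is only one coset.\<close>

lemma trivial_local_homology_group:
  assumes additive: "\<And>q. Modules.additive (local_boundary L q)"
    and cycles: "\<And>c. c \<in> local_chains X p \<Longrightarrow> local_boundary L p c = 0 \<Longrightarrow>
      c \<in> local_boundary L (Suc p) ` local_chains X (Suc p)"
  shows "trivial_group (local_homology_group X L p)"
proof -
  let ?Z = "local_cycle_group X L p" and ?B = "local_boundary L (Suc p) ` local_chains X (Suc p)"
  interpret B: Modules.additive "local_boundary L (Suc p)" by (fact additive)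
  have chains_add: "c + d \<in> local_chains X (Suc p)"
    if "c \<in> local_chains X (Suc p)" "d \<in> local_chains X (Suc p)" for c d
    using that Poly_Mapping.keys_add[of c d] by (auto simp: local_chains_def)
  have chains_minus: "- c \<in> local_chains X (Suc p)" if "c \<in> local_chains X (Suc p)" for c
    using that by (auto simp: local_chains_def in_keys_iff)
  have zero: "0 \<in> ?B"
    by (rule image_eqI[of _ _ 0]) (auto simp: local_chains_def B.zero)
  have add: "b + c \<in> ?B" if "b \<in> ?B" "c \<in> ?B" for b c
    using that by (auto simp: chains_add simp flip: B.add)
  have minus: "- b \<in> ?B" if "b \<in> ?B" for b
    using that by (auto simp: chains_minus simp flip: B.minus)
  have translate: "(\<Union>b\<in>?B. {b + c}) = ?B" if "c \<in> ?B" for c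
  proof
    show "(\<Union>b\<in>?B. {b + c}) \<subseteq> ?B" using add that by blast
    show "?B \<subseteq> (\<Union>b\<in>?B. {b + c})"
    proof
      fix b assume "b \<in> ?B"
      then have "b + - c \<in> ?B" using add minus that by blast
      then show "b \<in> (\<Union>b\<in>?B. {b + c})" by (rule UN_I) simp
    qed
  qed
  have "carrier (?Z Mod ?B) = {?B}"
  proof -
    have "0 \<in> carrier ?Z"
      by (simp add: local_cycle_group_def local_chains_def additive.zero[OF additive])
    moreover have "c \<in> ?B" if "c \<in> carrier ?Z" for c
      using that cycles by (auto simp: local_cycle_group_def)
    ultimately show ?thesis
      using translate
      by (auto simp: FactGroup_def RCOSETS_def r_coset_def local_cycle_group_def)
  qed
  moreover have "?B <#>\<^bsub>?Z\<^esub> ?B = ?B"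
  proof -
    have "?B <#>\<^bsub>?Z\<^esub> ?B = (\<Union>c\<in>?B. \<Union>b\<in>?B. {b + c})"
      by (auto simp: set_mult_def local_cycle_group_def)
    also have "\<dots> = ?B" using translate zero by auto
    finally show ?thesis .
  qed
  ultimately show ?thesis
    unfolding trivial_group_def local_homology_group_def
    by (auto simp: FactGroup_def intro!: groupI)
qed

text \<open>Twice a cycle is a boundary by the chain homotopy, and a rational cycle is twice its half, which
  is again a cycle because rational chains have no torsion.\<close>

lemma trivial_rational_local_homology_group:
  fixes L :: "('a, rat) transport"
  assumes "inverting_homotopy X L H"
  shows "trivial_group (local_homology_group X L p)"
proof (rule trivial_local_homology_group)
  interpret inverting_homotopy X L H by fact
  show "Modules.additive (local_boundary L q)" for q
    by (intro additive_local_boundary additive_transport)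
  interpret B: Modules.additive "local_boundary L p"
    by (intro additive_local_boundary additive_transport)
  fix c assume c: "c \<in> local_chains X p" "local_boundary L p c = 0"
  define d where "d = Poly_Mapping.map (\<lambda>q. q / 2) c"
  have lookup_d: "Poly_Mapping.lookup d \<sigma> = Poly_Mapping.lookup c \<sigma> / 2" for \<sigma>
    by (simp add: d_def Poly_Mapping.map.rep_eq when_def)
  have "d + d = c"
    by (rule poly_mapping_eqI) (simp add: lookup_add lookup_d)
  then have "local_boundary L p d + local_boundary L p d = 0"
    using c(2) by (simp flip: B.add)
  then have "Poly_Mapping.lookup (local_boundary L p d) \<tau> + Poly_Mapping.lookup (local_boundary L p d) \<tau> = 0" for \<tau>
    by (metis lookup_add lookup_zero)
  then have "local_boundary L p d = 0"
    by (intro poly_mapping_eqI) simp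
  moreover have "d \<in> local_chains X p"
    using c(1) by (auto simp: local_chains_def in_keys_iff lookup_d)
  ultimately show "c \<in> local_boundary L (Suc p) ` local_chains X (Suc p)"
    using double_cycle_is_boundary \<open>d + d = c\<close> by blast
qed

section \<open>The sphere and projective space\<close>

lemma topspace_nsphere: "topspace (nsphere m) = {x. (\<Sum>i\<le>m. (x i)\<^sup>2) = 1 \<and> (\<forall>i>m. x i = 0)}"
  by (simp add: nsphere)

lemma continuous_map_into_nsphere:
  "continuous_map X (nsphere m) f \<longleftrightarrow>
     (\<forall>i. continuous_map X euclideanreal (\<lambda>x. f x i)) \<and> f \<in> topspace X \<rightarrow> topspace (nsphere m)"
  by (auto simp: nsphere continuous_map_in_subtopology continuous_map_componentwise_UNIV)

lemma uminus_in_nsphere: "(\<lambda>i. - x i) \<in> topspace (nsphere m) \<longleftrightarrow> x \<in> topspace (nsphere m)"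
  by (simp add: topspace_nsphere)

lemma antipodal_pair_eq_iff: "antipodal_pair x = antipodal_pair y \<longleftrightarrow> x = y \<or> x = (\<lambda>i. - y i)"
  by (auto simp: antipodal_pair_def doubleton_eq_iff fun_eq_iff)

lemma antipodal_pair_eqE:
  assumes "antipodal_pair x = antipodal_pair y"
  obtains q :: real where "q \<in> {1, -1}" "x = (\<lambda>i. q * y i)"
  using assms unfolding antipodal_pair_eq_iff by (elim disjE) (rule that[of 1] that[of "-1"]; simp)+

lemma antipodal_pair_uminus [simp]: "antipodal_pair (\<lambda>i. - x i) = antipodal_pair x"
  by (simp add: antipodal_pair_eq_iff)

definition sphere_inner :: "nat \<Rightarrow> (nat \<Rightarrow> real) \<Rightarrow> (nat \<Rightarrow> real) \<Rightarrow> real" where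
  "sphere_inner m x y = (\<Sum>i\<le>m. x i * y i)"

lemma sphere_inner_self: "x \<in> topspace (nsphere m) \<Longrightarrow> sphere_inner m x x = 1"
  by (simp add: sphere_inner_def topspace_nsphere power2_eq_square)

lemma sphere_inner_uminus [simp]:
  "sphere_inner m (\<lambda>i. - x i) y = - sphere_inner m x y"
  "sphere_inner m x (\<lambda>i. - y i) = - sphere_inner m x y"
  by (simp_all add: sphere_inner_def sum_negf)

text \<open>The entries of the matrix \<open>x x\<^sup>T\<close> of the orthogonal projection onto the line through \<open>x\<close>. They are continuous
  functions on projective space that determine a point, and they give continuity statements about
  lifts without any reference to the quotient topology.\<close>

definition coordinate_product :: "nat \<Rightarrow> nat \<Rightarrow> (nat \<Rightarrow> real) set \<Rightarrow> real" where
  "coordinate_product i j A = (let x = (SOME x. x \<in> A) in x i * x j)"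

lemma coordinate_product_antipodal_pair [simp]:
  "coordinate_product i j (antipodal_pair x) = x i * x j"
proof -
  have "(SOME y. y \<in> antipodal_pair x) \<in> antipodal_pair x"
    by (rule someI[of _ x]) (simp add: antipodal_pair_def)
  then show ?thesis by (auto simp: coordinate_product_def Let_def antipodal_pair_def)
qed

lemma continuous_map_coordinate_product:
  "continuous_map (RP m) euclideanreal (coordinate_product i j)"
  by (rule continuous_compose_quotient_map[OF quotient_map_RP])
    (auto simp: o_def intro!: continuous_map_real_mult continuous_map_nsphere_projection)

lemma sum_coordinate_products:
  "(\<Sum>i\<le>m. \<Sum>j\<le>m. coordinate_product i j (antipodal_pair x) * coordinate_product i j (antipodal_pair y)) =
     (sphere_inner m x y)\<^sup>2"
  by (simp add: sphere_inner_def power2_eq_square sum_product algebra_simps)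

section \<open>Lifting paths from projective space to the sphere\<close>

definition is_lift :: "nat \<Rightarrow> (real \<Rightarrow> (nat \<Rightarrow> real) set) \<Rightarrow> (real \<Rightarrow> nat \<Rightarrow> real) \<Rightarrow> bool" where
  "is_lift m h \<gamma> \<longleftrightarrow> pathin (nsphere m) \<gamma> \<and> (\<forall>t\<in>{0..1}. antipodal_pair (\<gamma> t) = h t)"

lemma is_lift_uminus: "is_lift m h (\<lambda>t i. - \<gamma> t i) \<longleftrightarrow> is_lift m h \<gamma>"
proof -
  have "is_lift m h (\<lambda>t i. - \<gamma> t i)" if "is_lift m h \<gamma>" for \<gamma>
    using that continuous_map_minus[of "top_of_set {0..1}" "\<lambda>t. \<gamma> t _"]
    by (auto simp: is_lift_def pathin_def continuous_map_into_nsphere uminus_in_nsphere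
        intro!: continuous_map_minus continuous_intros)
  from this[of \<gamma>] this[of "\<lambda>t i. - \<gamma> t i"] show ?thesis by auto
qed

text \<open>Path lifting for the double covering of projective space. Near a parameter where the coordinate
  \<open>x\<^sub>i\<close> of the representatives does not vanish, choose the representative with \<open>x\<^sub>i > 0\<close>; its coordinates are
  \<open>x\<^sub>i x\<^sub>j / \<bar>x\<^sub>i\<bar>\<close>. Lifts over adjacent intervals are glued after changing the sign of one of them if
  necessary, so the compactness argument of Bolzano applies.\<close>

lemma path_lift_exists:
  assumes "pathin (RP m) h"
  shows "\<exists>\<gamma>. is_lift m h \<gamma>"
proof -
  let ?lift = "\<lambda>a b \<gamma>. (\<forall>i. continuous_on {a..b} (\<lambda>t. \<gamma> t i)) \<and>
      (\<forall>t\<in>{a..b}. \<gamma> t \<in> topspace (nsphere m) \<and> antipodal_pair (\<gamma> t) = h t)"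
  have Q: "continuous_on {0..1} (\<lambda>t. coordinate_product i j (h t))" for i j
    using continuous_map_compose[OF assms[unfolded pathin_def] continuous_map_coordinate_product]
    by (simp add: o_def)
  have rep: "\<exists>y \<in> topspace (nsphere m). h t = antipodal_pair y" if "t \<in> {0..1}" for t
  proof -
    have "h t \<in> topspace (RP m)" using path_image_subset_topspace[OF assms] that by blast
    then show ?thesis by (auto simp: topspace_RP)
  qed
  have "0 \<le> (0::real) \<and> (1::real) \<le> 1 \<longrightarrow> (\<exists>\<gamma>. ?lift 0 1 \<gamma>)"
  proof (rule Bolzano[of 0 1 "\<lambda>a b. 0 \<le> a \<and> b \<le> 1 \<longrightarrow> (\<exists>\<gamma>. ?lift a b \<gamma>)"])
    fix a b c :: real
    assume 1: "0 \<le> a \<and> b \<le> 1 \<longrightarrow> (\<exists>\<gamma>. ?lift a b \<gamma>)" and 2: "0 \<le> b \<and> c \<le> 1 \<longrightarrow> (\<exists>\<gamma>. ?lift b c \<gamma>)"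
      and "a \<le> b" "b \<le> c"
    show "0 \<le> a \<and> c \<le> 1 \<longrightarrow> (\<exists>\<gamma>. ?lift a c \<gamma>)"
    proof
      assume "0 \<le> a \<and> c \<le> 1"
      then obtain \<gamma> \<delta> where \<gamma>: "?lift a b \<gamma>" and \<delta>: "?lift b c \<delta>"
        using 1 2 \<open>a \<le> b\<close> \<open>b \<le> c\<close> by (meson order_trans)
      have "antipodal_pair (\<gamma> b) = antipodal_pair (\<delta> b)"
        using \<gamma> \<delta> \<open>a \<le> b\<close> \<open>b \<le> c\<close> by simp
      then obtain \<delta>' where \<delta>': "?lift b c \<delta>'" "\<gamma> b = \<delta>' b"
        unfolding antipodal_pair_eq_iff
      proof
        assume "\<gamma> b = (\<lambda>i. - \<delta> b i)"
        then show thesis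
          using \<delta> by (intro that[of "\<lambda>t i. - \<delta> t i"]) (auto simp: uminus_in_nsphere intro!: continuous_on_minus)
      qed (use \<delta> that in blast)
      have split: "{a..c} = {a..b} \<union> {b..c}" using \<open>a \<le> b\<close> \<open>b \<le> c\<close> by auto
      have "continuous_on {a..c} (\<lambda>t. if t \<le> b then \<gamma> t i else \<delta>' t i)" for i
        unfolding split using \<gamma> \<delta>' by (intro continuous_on_cases) auto
      then have "?lift a c (\<lambda>t. if t \<le> b then \<gamma> t else \<delta>' t)"
        using \<gamma> \<delta>' by (auto simp: if_distrib[of "\<lambda>f. f _"])
      then show "\<exists>\<gamma>. ?lift a c \<gamma>"
        by (rule exI[where x = "\<lambda>t. if t \<le> b then \<gamma> t else \<delta>' t"])
    qed
  next
    fix x :: real assume x: "0 \<le> x" "x \<le> 1"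
    obtain y where y: "y \<in> topspace (nsphere m)" "h x = antipodal_pair y"
      using rep x by auto
    then obtain i where "y i \<noteq> 0"
      by (fastforce simp: topspace_nsphere)
    then have "coordinate_product i i (h x) > 0"
      by (simp add: y not_less_iff_gr_or_eq zero_less_mult_iff) linarith
    moreover have "\<exists>d>0. \<forall>t\<in>{0..1}. dist t x < d \<longrightarrow>
        dist (coordinate_product i i (h t)) (coordinate_product i i (h x)) < coordinate_product i i (h x)"
      using Q[of i i] x calculation unfolding continuous_on_iff by auto
    ultimately obtain d where "d > 0"
      and d: "\<And>t. t \<in> {0..1} \<Longrightarrow> \<bar>t - x\<bar> < d \<Longrightarrow> coordinate_product i i (h t) > 0"
      unfolding dist_real_def by (smt (verit))
    have "\<exists>\<gamma>. ?lift a b \<gamma>" if ab: "a \<le> x" "x \<le> b" "b - a < d" "0 \<le> a" "b \<le> 1" for a b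
    proof (intro exI conjI allI ballI)
      let ?\<gamma> = "\<lambda>t j. coordinate_product i j (h t) / sqrt (coordinate_product i i (h t))"
      have pos: "coordinate_product i i (h t) > 0" if "t \<in> {a..b}" for t
        using d[of t] that ab by auto
      show "continuous_on {a..b} (\<lambda>t. ?\<gamma> t j)" for j
        using pos ab by (intro continuous_intros continuous_on_subset[OF Q]) force+
      fix t assume t: "t \<in> {a..b}"
      then obtain z where z: "z \<in> topspace (nsphere m)" "h t = antipodal_pair z"
        using rep[of t] ab by auto
      have "?\<gamma> t = z \<or> ?\<gamma> t = (\<lambda>j. - z j)"
        using pos[OF t] by (cases "z i > 0") (auto simp: z fun_eq_iff zero_less_mult_iff)
      then have "?\<gamma> t \<in> topspace (nsphere m) \<and> antipodal_pair (?\<gamma> t) = h t"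
      proof
        assume "?\<gamma> t = z"
        then show ?thesis using z by (simp only:)
      next
        assume "?\<gamma> t = (\<lambda>j. - z j)"
        then show ?thesis using z by (simp only: uminus_in_nsphere antipodal_pair_uminus)
      qed
      then show "?\<gamma> t \<in> topspace (nsphere m)" "antipodal_pair (?\<gamma> t) = h t"
        by (rule conjunct1, rule conjunct2)
    qed
    then show "\<exists>d>0. \<forall>a b. a \<le> x \<and> x \<le> b \<and> b - a < d \<longrightarrow> 0 \<le> a \<and> b \<le> 1 \<longrightarrow> (\<exists>\<gamma>. ?lift a b \<gamma>)"
      using \<open>d > 0\<close> by blast
  qed simp
  then show ?thesis
    by (auto simp: is_lift_def pathin_def continuous_map_into_nsphere)
qed

lemma lift_from:
  assumes "pathin (RP m) h" "h 0 = antipodal_pair x"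
  obtains \<gamma> where "is_lift m h \<gamma>" "\<gamma> 0 = x"
proof -
  obtain \<gamma> where \<gamma>: "is_lift m h \<gamma>" using path_lift_exists assms(1) by blast
  then have "antipodal_pair x = antipodal_pair (\<gamma> 0)" using assms(2) by (simp add: is_lift_def)
  then show thesis
    unfolding antipodal_pair_eq_iff using that \<gamma> is_lift_uminus[of m h \<gamma>] by auto
qed

lemma sphere_inner_pos_at_end:
  assumes "pathin (nsphere m) \<gamma>" "pathin (nsphere m) \<delta>"
    and nz: "\<And>t. t \<in> {0..1} \<Longrightarrow> sphere_inner m (\<gamma> t) (\<delta> t) \<noteq> 0" and "\<gamma> 0 = \<delta> 0"
  shows "sphere_inner m (\<gamma> 1) (\<delta> 1) > 0"
proof (rule ccontr)
  have "continuous_on {0..1} (\<lambda>t. sphere_inner m (\<gamma> t) (\<delta> t))"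
    unfolding sphere_inner_def
    using assms(1,2) by (intro continuous_intros) (auto simp: pathin_def continuous_map_into_nsphere)
  moreover have "sphere_inner m (\<gamma> 0) (\<delta> 0) = 1"
    using assms sphere_inner_self path_start_in_topspace by metis
  moreover assume "\<not> ?thesis"
  ultimately have "\<exists>t\<ge>0. t \<le> 1 \<and> sphere_inner m (\<gamma> t) (\<delta> t) = 0"
    by (intro IVT2') auto
  then show False using nz by auto
qed

text \<open>The inner product of the two lifts starts at \<open>1\<close> and never vanishes, so it is positive at the
  end. There the lifts agree up to sign, hence they agree.\<close>

lemma lifts_of_nonorthogonal_paths_end_together:
  assumes "is_lift m h \<gamma>" "is_lift m h' \<delta>" "\<gamma> 0 = \<delta> 0" "h 1 = h' 1"
    and "\<And>t. t \<in> {0..1} \<Longrightarrow> sphere_inner m (\<gamma> t) (\<delta> t) \<noteq> 0"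
  shows "\<gamma> 1 = \<delta> 1"
proof -
  have "sphere_inner m (\<gamma> 1) (\<delta> 1) > 0"
    using assms by (intro sphere_inner_pos_at_end) (auto simp: is_lift_def)
  moreover have "antipodal_pair (\<gamma> 1) = antipodal_pair (\<delta> 1)"
    using assms by (simp add: is_lift_def)
  moreover have "\<delta> 1 \<in> topspace (nsphere m)"
    using assms(2) path_finish_in_topspace by (auto simp: is_lift_def)
  ultimately show ?thesis by (auto simp: antipodal_pair_eq_iff sphere_inner_self)
qed

lemma lift_end_unique:
  assumes "is_lift m h \<gamma>" "is_lift m h \<delta>" "\<gamma> 0 = \<delta> 0"
  shows "\<gamma> 1 = \<delta> 1"
proof (rule lifts_of_nonorthogonal_paths_end_together[OF assms refl])
  fix t :: real assume t: "t \<in> {0..1}"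
  then have "antipodal_pair (\<gamma> t) = antipodal_pair (\<delta> t)" "\<delta> t \<in> topspace (nsphere m)"
    using assms path_image_subset_topspace[of "nsphere m" \<delta>] by (auto simp: is_lift_def)
  then show "sphere_inner m (\<gamma> t) (\<delta> t) \<noteq> 0"
    by (auto simp: antipodal_pair_eq_iff sphere_inner_self)
qed

text \<open>Lift all intermediate paths from the same starting point. By uniform continuity of the squared
  inner products, the lifts of intermediate paths with nearby parameters are nowhere orthogonal, so
  their end points agree: the end point is locally constant in the parameter of the homotopy.\<close>

lemma lifts_of_homotopic_paths_end_together:
  assumes "path_homotopic (RP m) h h'" "is_lift m h \<gamma>" "is_lift m h' \<gamma>'" "\<gamma> 0 = \<gamma>' 0"
  shows "\<gamma> 1 = \<gamma>' 1"
proof -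
  obtain K :: "real \<times> real \<Rightarrow> (nat \<Rightarrow> real) set"
    where K: "continuous_map (prod_topology (top_of_set {0..1}) (top_of_set {0..1})) (RP m) K"
    and K01: "\<forall>t. K (0, t) = h t" "\<forall>t. K (1, t) = h' t"
    and ends: "\<forall>s\<in>{0..1}. K (s, 0) = h 0 \<and> K (s, 1) = h 1"
    using assms(1) unfolding path_homotopic_def homotopic_with_def by (elim exE conjE) (rule that)
  have "pathin (RP m) (\<lambda>t. K (s, t))" if "s \<in> {0..1}" for s
  proof -
    have "continuous_map (top_of_set {0..1}) (prod_topology (top_of_set {0..1}) (top_of_set {0..1}))
        (\<lambda>t. (s, t))"
      unfolding continuous_map_pairwise o_def using that by simp
    from continuous_map_compose[OF this K] show ?thesis by (simp only: pathin_def o_def)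
  qed
  moreover have "h 0 = antipodal_pair (\<gamma> 0)"
    using assms(2) by (simp add: is_lift_def)
  ultimately have "\<exists>\<delta>. is_lift m (\<lambda>t. K (s, t)) \<delta> \<and> \<delta> 0 = \<gamma> 0" if "s \<in> {0..1}" for s
    using lift_from[of m "\<lambda>t. K (s, t)" "\<gamma> 0"] ends that by metis
  then obtain \<Gamma> where \<Gamma>: "\<And>s. s \<in> {0..1} \<Longrightarrow> is_lift m (\<lambda>t. K (s, t)) (\<Gamma> s)"
      and \<Gamma>0: "\<And>s. s \<in> {0..1} \<Longrightarrow> \<Gamma> s 0 = \<gamma> 0"
    by metis
  have lift: "K (s, t) = antipodal_pair (\<Gamma> s t)" "\<Gamma> s t \<in> topspace (nsphere m)"
    if "s \<in> {0..1}" "t \<in> {0..1}" for s t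
    using \<Gamma>[OF that(1)] that path_image_subset_topspace[of "nsphere m" "\<Gamma> s"]
    by (auto simp: is_lift_def)
  have Q: "continuous_on ({0..1} \<times> {0..1}) (\<lambda>z. coordinate_product i j (K z))" for i j
    using continuous_map_compose[OF K continuous_map_coordinate_product[of m i j]]
    by (simp add: o_def)
  have "0 \<in> {0..1::real} \<and> 1 \<in> {0..1::real} \<longrightarrow> \<Gamma> 0 1 = \<Gamma> 1 1"
  proof (rule Bolzano[of 0 1 "\<lambda>a b. a \<in> {0..1} \<and> b \<in> {0..1} \<longrightarrow> \<Gamma> a 1 = \<Gamma> b 1"])
    fix x :: real assume "0 \<le> x" "x \<le> 1"
    then have x: "x \<in> {0..1}" by simp
    \<comment> \<open>The squared inner product of the lifts at \<open>s\<close> and at \<open>x\<close>, expressed through projective space, where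
      joint continuity in \<open>s\<close> and \<open>t\<close> is known.\<close>
    define f where "f z = (\<Sum>i\<le>m. \<Sum>j\<le>m. coordinate_product i j (K z) * coordinate_product i j (K (x, snd z)))" for z
    have f: "f (s, t) = (sphere_inner m (\<Gamma> s t) (\<Gamma> x t))\<^sup>2" if "s \<in> {0..1}" "t \<in> {0..1}" for s t
      by (simp only: f_def lift that x snd_conv sum_coordinate_products)
    have "continuous_on ({0..1} \<times> {0..1}) (\<lambda>z. coordinate_product i j (K (x, snd z)))" for i j
      by (rule continuous_on_compose2[OF Q]) (use x in \<open>auto intro!: continuous_intros\<close>)
    then have "continuous_on ({0..1} \<times> {0..1}) f"
      unfolding f_def by (intro continuous_intros Q)
    then have "uniformly_continuous_on ({0..1} \<times> {0..1}) f"
      by (intro compact_uniformly_continuous compact_Times compact_Icc)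
    then obtain d where "d > 0" and d: "\<And>z w. z \<in> {0..1} \<times> {0..1} \<Longrightarrow> w \<in> {0..1} \<times> {0..1} \<Longrightarrow>
        dist w z < d \<Longrightarrow> dist (f w) (f z) < 1"
      unfolding uniformly_continuous_on_def using zero_less_one by metis
    have "\<Gamma> s 1 = \<Gamma> x 1" if s: "s \<in> {0..1}" "\<bar>s - x\<bar> < d" for s
    proof (rule lifts_of_nonorthogonal_paths_end_together[OF \<Gamma> \<Gamma>])
      fix t :: real assume t: "t \<in> {0..1}"
      have "dist (s, t) (x, t) < d" using s by (simp add: dist_Pair_Pair dist_real_def)
      moreover have "f (x, t) = 1" using x t lift(2)[OF x t] by (simp only: f sphere_inner_self one_power2)
      ultimately have "f (s, t) \<noteq> 0" using d[of "(x, t)" "(s, t)"] x s t by (auto simp: dist_real_def)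
      then show "sphere_inner m (\<Gamma> s t) (\<Gamma> x t) \<noteq> 0" unfolding f[OF s(1) t] by simp
    qed (use s x \<Gamma>0 ends in auto)
    then show "\<exists>d>0. \<forall>a b. a \<le> x \<and> x \<le> b \<and> b - a < d \<longrightarrow>
        a \<in> {0..1} \<and> b \<in> {0..1} \<longrightarrow> \<Gamma> a 1 = \<Gamma> b 1"
      using \<open>d > 0\<close> by (intro exI[of _ d]) (smt (verit))
  qed auto
  moreover have "\<gamma> 1 = \<Gamma> 0 1"
    using \<Gamma>[of 0] \<Gamma>0[of 0] by (intro lift_end_unique[OF assms(2)]) (auto simp: K01)
  moreover have "\<gamma>' 1 = \<Gamma> 1 1"
    using \<Gamma>[of 1] \<Gamma>0[of 1] assms(4) by (intro lift_end_unique[OF assms(3)]) (auto simp: K01)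
  ultimately show ?thesis by simp
qed

section \<open>Path operations and local systems\<close>

lemma pathin_join_paths:
  assumes "pathin X g" "pathin X h" "g 1 = h 0"
  shows "pathin X (join_paths g h)"
  unfolding pathin_def join_paths_def
proof (rule continuous_map_cases_le)
  have left: "{0..1} \<inter> {t \<in> {0..1}. t \<le> 1/2} = {0..1/2::real}" by auto
  have "continuous_map (top_of_set {0..1/2}) (top_of_set {0..1}) (\<lambda>t::real. 2 * t)"
    by (auto intro!: continuous_intros)
  from continuous_map_compose[OF this] assms(1)
  show "continuous_map (subtopology (top_of_set {0..1}) {t \<in> topspace (top_of_set {0..1}). t \<le> 1 / 2}) X
      (\<lambda>t. g (2 * t))"
    unfolding subtopology_subtopology topspace_euclidean_subtopology left by (simp add: pathin_def o_def)
  have right: "{0..1} \<inter> {t \<in> {0..1}. 1/2 \<le> t} = {1/2..1::real}" by auto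
  have "continuous_map (top_of_set {1/2..1}) (top_of_set {0..1}) (\<lambda>t::real. 2 * t - 1)"
    by (auto intro!: continuous_intros)
  from continuous_map_compose[OF this] assms(2)
  show "continuous_map (subtopology (top_of_set {0..1}) {t \<in> topspace (top_of_set {0..1}). 1 / 2 \<le> t}) X
      (\<lambda>t. h (2 * t - 1))"
    unfolding subtopology_subtopology topspace_euclidean_subtopology right by (simp add: pathin_def o_def)
  fix t :: real assume "t = 1 / 2"
  then show "g (2 * t) = h (2 * t - 1)" using assms(3) by (simp only:) simp
qed auto

lemma pathin_reverse_path:
  assumes "pathin X g"
  shows "pathin X (reverse_path g)"
proof -
  have "continuous_map (top_of_set {0..1}) (top_of_set {0..1}) (\<lambda>t::real. 1 - t)"
    by (auto intro!: continuous_intros)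
  from continuous_map_compose[OF this] show ?thesis
    using assms by (simp add: pathin_def reverse_path_def[abs_def] o_def)
qed

lemma path_homotopic_cong:
  assumes "pathin X g" "\<And>t. t \<in> {0..1} \<Longrightarrow> g t = h t"
  shows "path_homotopic X g h"
  unfolding path_homotopic_def
  using assms by (intro homotopic_with_equal) (auto simp: pathin_def)

lemma path_homotopic_join_reverse:
  assumes "pathin X g"
  shows "path_homotopic X (join_paths g (reverse_path g)) (\<lambda>_. g 0)"
  unfolding path_homotopic_def homotopic_with_def
proof (intro exI conjI allI ballI)
  \<comment> \<open>At time \<open>s\<close>, follow \<open>g\<close> only up to the parameter \<open>1 - s\<close> and then turn back.\<close>
  let ?k = "\<lambda>(s::real, t::real). g ((1 - s) * min (2 * t) (2 - 2 * t))"
  have "continuous_on ({0..1} \<times> {0..1})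
      (\<lambda>z::real \<times> real. (1 - fst z) * min (2 * snd z) (2 - 2 * snd z))"
    by (intro continuous_intros)
  then have "continuous_map (prod_topology (top_of_set {0..1}) (top_of_set {0..1})) (top_of_set {0..1})
      (\<lambda>z::real \<times> real. (1 - fst z) * min (2 * snd z) (2 - 2 * snd z))"
    by (auto intro!: mult_le_one)
  from continuous_map_compose[OF this] 
  show "continuous_map (prod_topology (top_of_set {0..1}) (top_of_set {0..1})) X ?k"
    using assms by (simp add: pathin_def o_def case_prod_beta')
qed (auto simp: join_paths_def reverse_path_def min_def)

lemma local_system_additive:
  assumes "local_system X L" "pathin X g"
  shows "Modules.additive (L g)"
  using assms by (simp add: local_system_def additive_def)

lemma local_system_cong:
  assumes "local_system X L" "pathin X g" "\<And>t. t \<in> {0..1} \<Longrightarrow> g t = h t"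
  shows "L g = L h"
  using assms path_homotopic_cong[of X g h] unfolding local_system_def by blast

text \<open>A constant path is its own square, so its transport is an idempotent bijection.\<close>

lemma local_system_const:
  assumes "local_system X L" "x \<in> topspace X"
  shows "L (\<lambda>_. x) = id"
proof -
  have path: "pathin X (\<lambda>_. x)" using assms by simp
  have "join_paths (\<lambda>_. x) (\<lambda>_. x) = (\<lambda>_. x)" by (auto simp: join_paths_def)
  then have "L (\<lambda>_. x) \<circ> L (\<lambda>_. x) = L (\<lambda>_. x)"
    using assms(1) path unfolding local_system_def by metis
  moreover have "bij (L (\<lambda>_. x))"
    using assms(1) path unfolding local_system_def by blast
  ultimately show ?thesis
    by (auto simp: fun_eq_iff dest: bij_is_inj injD)
qed

lemma local_system_reverse:
  assumes "local_system X L" "pathin X g"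
  shows "L (reverse_path g) (L g a) = a"
proof -
  have "L (join_paths g (reverse_path g)) = L (reverse_path g) \<circ> L g"
    using assms pathin_reverse_path[of X g] unfolding local_system_def
    by (simp add: reverse_path_def)
  moreover have "L (join_paths g (reverse_path g)) = L (\<lambda>_. g 0)"
    using assms path_homotopic_join_reverse unfolding local_system_def by blast
  moreover have "L (\<lambda>_. g 0) = id"
    using assms by (intro local_system_const) (auto intro: path_start_in_topspace)
  ultimately show ?thesis by (metis comp_apply id_apply)
qed

section \<open>The sign of a loop in projective space\<close>

lemma is_lift_join_paths:
  assumes "is_lift m g \<gamma>" "is_lift m h \<delta>" "\<gamma> 1 = \<delta> 0"
  shows "is_lift m (join_paths g h) (join_paths \<gamma> \<delta>)"
  using assms pathin_join_paths[of "nsphere m" \<gamma> \<delta>] unfolding is_lift_def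
  by (auto simp: join_paths_def)

lemma is_lift_reverse_path:
  assumes "is_lift m g \<gamma>"
  shows "is_lift m (reverse_path g) (reverse_path \<gamma>)"
  using assms pathin_reverse_path[of "nsphere m" \<gamma>] unfolding is_lift_def
  by (auto simp: reverse_path_def)

lemma is_lift_scale:
  assumes "is_lift m h \<gamma>" "s \<in> {1, -1}"
  shows "is_lift m h (\<lambda>t i. s * \<gamma> t i)"
  using assms by (auto simp: is_lift_uminus)

lemma join_paths_ends: "join_paths g h 0 = g 0" "join_paths g h 1 = h 1"
  by (simp_all add: join_paths_def)

lemma reverse_path_ends: "reverse_path g 0 = g 1" "reverse_path g 1 = g 0"
  by (simp_all add: reverse_path_def)

text \<open>The monodromy of the double covering along a loop: \<open>s\<close> is \<open>1\<close> if the lifts are closed and \<open>-1\<close> if they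
  join antipodal points.\<close>

definition loop_sign :: "nat \<Rightarrow> (real \<Rightarrow> (nat \<Rightarrow> real) set) \<Rightarrow> real \<Rightarrow> bool" where
  "loop_sign m h s \<longleftrightarrow> s \<in> {1, -1} \<and> (\<exists>\<gamma>. is_lift m h \<gamma> \<and> \<gamma> 1 = (\<lambda>i. s * \<gamma> 0 i))"

lemma loop_sign_exists:
  assumes "loopin (RP m) h"
  obtains s where "loop_sign m h s"
proof -
  obtain \<gamma> where \<gamma>: "is_lift m h \<gamma>" using assms path_lift_exists unfolding loopin_def by blast
  then have "antipodal_pair (\<gamma> 1) = antipodal_pair (\<gamma> 0)"
    using assms by (simp add: is_lift_def loopin_def)
  then show thesis
    unfolding antipodal_pair_eq_iff using \<gamma> that[of 1] that[of "-1"] by (auto simp: loop_sign_def)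
qed

lemma loop_sign_homotopic:
  assumes "path_homotopic (RP m) h h'" "loop_sign m h s" "loop_sign m h' s'"
  shows "s = s'"
proof -
  obtain \<gamma> \<gamma>' where \<gamma>: "is_lift m h \<gamma>" "\<gamma> 1 = (\<lambda>i. s * \<gamma> 0 i)"
      and \<gamma>': "is_lift m h' \<gamma>'" "\<gamma>' 1 = (\<lambda>i. s' * \<gamma>' 0 i)"
    using assms(2,3) by (auto simp: loop_sign_def)
  have "h' 0 = h 0"
    using homotopic_with_imp_property[OF assms(1)[unfolded path_homotopic_def]] by simp
  then have "antipodal_pair (\<gamma> 0) = antipodal_pair (\<gamma>' 0)"
    using \<gamma> \<gamma>' by (simp add: is_lift_def)
  then obtain r where r: "r \<in> {1, -1}" "\<gamma> 0 = (\<lambda>i. r * \<gamma>' 0 i)"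
    by (rule antipodal_pair_eqE)
  have "\<gamma> 1 = (\<lambda>i. r * \<gamma>' 1 i)"
    using lifts_of_homotopic_paths_end_together[OF assms(1) \<gamma>(1) is_lift_scale[OF \<gamma>'(1) r(1)]] r(2) by simp
  then have eq: "s * \<gamma> 0 i = s' * \<gamma> 0 i" for i
    unfolding \<gamma>(2) \<gamma>'(2) r(2) by (auto simp: fun_eq_iff algebra_simps)
  have "\<gamma> 0 \<in> topspace (nsphere m)"
    using \<gamma>(1) path_start_in_topspace by (auto simp: is_lift_def)
  then obtain i where "\<gamma> 0 i \<noteq> 0" by (fastforce simp: topspace_nsphere)
  then show ?thesis using eq[of i] by simp
qed

lemma loop_sign_join:
  assumes "loop_sign m g s" "loop_sign m h r" "g 1 = h 0"
  shows "loop_sign m (join_paths g h) (s * r)"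
proof -
  obtain \<gamma> \<delta> where \<gamma>: "is_lift m g \<gamma>" "\<gamma> 1 = (\<lambda>i. s * \<gamma> 0 i)"
      and \<delta>: "is_lift m h \<delta>" "\<delta> 1 = (\<lambda>i. r * \<delta> 0 i)"
    using assms(1,2) by (auto simp: loop_sign_def)
  have "antipodal_pair (\<gamma> 1) = antipodal_pair (\<delta> 0)"
    using \<gamma>(1) \<delta>(1) assms(3) by (simp add: is_lift_def)
  then obtain q where q: "q \<in> {1, -1}" "\<gamma> 1 = (\<lambda>i. q * \<delta> 0 i)"
    by (rule antipodal_pair_eqE)
  have "is_lift m (join_paths g h) (join_paths \<gamma> (\<lambda>t i. q * \<delta> t i))"
    using q by (intro is_lift_join_paths is_lift_scale \<gamma> \<delta>) auto
  moreover have "q * \<delta> 1 i = s * r * \<gamma> 0 i" for i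
  proof -
    have "q * \<delta> 1 i = r * (q * \<delta> 0 i)" by (simp add: \<delta>(2))
    also have "q * \<delta> 0 i = s * \<gamma> 0 i" using \<gamma>(2) q(2) by (metis (no_types))
    also have "r * (s * \<gamma> 0 i) = s * r * \<gamma> 0 i" by simp
    finally show ?thesis .
  qed
  ultimately show ?thesis
    using assms(1,2) by (auto simp: loop_sign_def join_paths_ends)
qed

lemma loop_sign_reverse:
  assumes "loop_sign m g s"
  shows "loop_sign m (reverse_path g) s"
proof -
  obtain \<gamma> where \<gamma>: "is_lift m g \<gamma>" "\<gamma> 1 = (\<lambda>i. s * \<gamma> 0 i)" and s: "s \<in> {1, -1}"
    using assms by (auto simp: loop_sign_def)
  then show ?thesis
    by (auto simp: loop_sign_def reverse_path_ends intro!: exI[of _ "reverse_path \<gamma>"] is_lift_reverse_path)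
qed

lemma loop_sign_const:
  assumes "A \<in> topspace (RP m)"
  shows "loop_sign m (\<lambda>_. A) 1"
proof -
  obtain x where "x \<in> topspace (nsphere m)" "A = antipodal_pair x"
    using assms by (auto simp: topspace_RP)
  then show ?thesis by (auto simp: loop_sign_def is_lift_def intro!: exI[of _ "\<lambda>_. x"])
qed

text \<open>Transport and sign of a power are recorded for the same exponent, since its parity is what links
  the two.\<close>

lemma transport_and_sign_loop_npower:
  assumes L: "local_system (RP m) L" and g: "loopin (RP m) g"
    and Lg: "\<And>a. L g a = - a" and s: "loop_sign m g s"
  shows "pathin (RP m) (loop_npower g n) \<and> loop_npower g n 0 = g 0 \<and> loop_npower g n 1 = g 0 \<and>
     (\<forall>a. L (loop_npower g n) a = (uminus ^^ n) a) \<and> loop_sign m (loop_npower g n) (s ^ n)"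
proof (induction n)
  case 0
  have "g 0 \<in> topspace (RP m)" using g path_start_in_topspace unfolding loopin_def by blast
  then show ?case using L by (simp add: local_system_const loop_sign_const)
next
  case (Suc n)
  have "L (join_paths (loop_npower g n) g) = L g \<circ> L (loop_npower g n)"
    using L Suc g unfolding local_system_def loopin_def by metis
  moreover have "loop_sign m (join_paths (loop_npower g n) g) (s ^ n * s)"
    using Suc s by (intro loop_sign_join) auto
  ultimately show ?case
    using Suc g by (auto simp: loopin_def join_paths_ends pathin_join_paths Lg mult.commute)
qed

section \<open>Transport along loops in projective space\<close>

text \<open>Choose representatives with nonnegative inner product. The segment between them then misses the
  origin, and its radial projection to the sphere joins them.\<close>

lemma path_connected_RP: "path_connected_space (RP m)"
  unfolding path_connected_space_def
proof (intro ballI)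
  fix A B assume "A \<in> topspace (RP m)" "B \<in> topspace (RP m)"
  then obtain x y where x: "x \<in> topspace (nsphere m)" "A = antipodal_pair x"
      and y: "y \<in> topspace (nsphere m)" "B = antipodal_pair y"
    by (auto simp: topspace_RP)
  obtain y' where y': "y' \<in> topspace (nsphere m)" "B = antipodal_pair y'" "sphere_inner m x y' \<ge> 0"
    using that[of y] that[of "\<lambda>i. - y i"] y uminus_in_nsphere[of y m]
    by (cases "sphere_inner m x y \<ge> 0") auto
  define N where "N t = (\<Sum>i\<le>m. ((1 - t) * x i + t * y' i)\<^sup>2)" for t
  define \<gamma> where "\<gamma> t i = ((1 - t) * x i + t * y' i) / sqrt (N t)" for t i
  have N: "N t = (1 - t)\<^sup>2 * sphere_inner m x x + t\<^sup>2 * sphere_inner m y' y' + 2 * t * (1 - t) * sphere_inner m x y'" for t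
    by (simp add: N_def sphere_inner_def sum_distrib_left power2_eq_square algebra_simps flip: sum.distrib)
  have pos: "N t > 0" if "t \<in> {0..1}" for t
  proof -
    have "(1 - t)\<^sup>2 + t\<^sup>2 > 0" by (cases "t = 0") (auto intro: add_nonneg_pos)
    moreover have "2 * t * (1 - t) * sphere_inner m x y' \<ge> 0" using that y'(3) by simp
    ultimately show ?thesis by (simp add: N sphere_inner_self x y')
  qed
  have "continuous_on {0..1} (\<lambda>t. \<gamma> t i)" for i
  proof -
    have "continuous_on {0..1} N" unfolding N_def by (intro continuous_intros)
    then show ?thesis unfolding \<gamma>_def using pos by (intro continuous_intros) force+
  qed
  moreover have "\<gamma> t \<in> topspace (nsphere m)" if "t \<in> {0..1}" for t
  proof -
    have "(\<Sum>i\<le>m. (\<gamma> t i)\<^sup>2) = N t / N t"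
      using pos[OF that] by (simp add: \<gamma>_def power_divide N_def flip: sum_divide_distrib)
    then show ?thesis
      using pos[OF that] x y' by (auto simp: topspace_nsphere \<gamma>_def)
  qed
  ultimately have "pathin (nsphere m) \<gamma>"
    by (auto simp: pathin_def continuous_map_into_nsphere)
  then have "pathin (RP m) (antipodal_pair \<circ> \<gamma>)"
    by (rule pathin_compose) (rule quotient_imp_continuous_map[OF quotient_map_RP])
  moreover have "N 0 = 1" "N 1 = 1" by (simp_all add: N sphere_inner_self x y')
  then have "\<gamma> 0 = x" "\<gamma> 1 = y'" by (simp_all add: \<gamma>_def fun_eq_iff)
  ultimately show "\<exists>g. pathin (RP m) g \<and> g 0 = A \<and> g 1 = B"
    using x y' by (intro exI[of _ "antipodal_pair \<circ> \<gamma>"]) simp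
qed

text \<open>Transport and the sign of the covering are both homomorphisms to \<open>{1, -1}\<close> on the cyclic fundamental
  group, and the transport of the generator is \<open>-1\<close>. Given a loop \<open>h\<close> with an open lift, two loops
  through the base point of the generator are compared, one that makes the detour along \<open>h\<close>
  and one that does not. Their signs are opposite, so the generator has sign \<open>-1\<close> and the two loops
  are powers of it of different parity. Hence their transports are opposite too, and cancelling the
  transport along the common parts leaves \<open>-1\<close> for \<open>h\<close>.\<close>

lemma transport_loop_with_open_lift:
  fixes L :: "((nat \<Rightarrow> real) set, int) transport"
  assumes L: "local_system (RP m) L" and g: "generates_fundamental_group (RP m) g"
    and Lg: "\<And>a. L g a = - a"
    and \<gamma>: "is_lift m h \<gamma>" "\<gamma> 1 = (\<lambda>i. - \<gamma> 0 i)"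
  shows "L h a = - a"
proof -
  have gloop: "loopin (RP m) g" using g by (simp add: generates_fundamental_group_def)
  have h: "pathin (RP m) h" "h 0 = h 1"
  proof -
    have "continuous_map (top_of_set {0..1}) (RP m) (antipodal_pair \<circ> \<gamma>)"
      using \<gamma>(1) quotient_imp_continuous_map[OF quotient_map_RP]
      by (auto simp: is_lift_def pathin_def intro: continuous_map_compose)
    then show "pathin (RP m) h"
      unfolding pathin_def by (rule continuous_map_eq) (use \<gamma>(1) in \<open>auto simp: is_lift_def\<close>)
    have "h 0 = antipodal_pair (\<gamma> 0)" "h 1 = antipodal_pair (\<gamma> 1)"
      using \<gamma>(1) by (auto simp: is_lift_def)
    then show "h 0 = h 1" by (simp add: \<gamma>(2))
  qed
  obtain s where s: "loop_sign m g s" using gloop loop_sign_exists by blast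
  have loops: "\<exists>n. (\<forall>a. L l a = (uminus ^^ n) a) \<and> (\<forall>r. loop_sign m l r \<longrightarrow> r = s ^ n)"
    if l: "loopin (RP m) l" "l 0 = g 0" for l
  proof -
    obtain k where k: "path_homotopic (RP m) (loop_power g k) l"
      using g l by (auto simp: generates_fundamental_group_def)
    have rev: "loopin (RP m) (reverse_path g)"
      using gloop by (simp add: loopin_def pathin_reverse_path reverse_path_ends)
    have Lrev: "L (reverse_path g) a = - a" for a
      using local_system_reverse[OF L, of g "- a"] gloop by (simp add: loopin_def Lg)
    have "\<exists>n. (\<forall>a. L (loop_power g k) a = (uminus ^^ n) a) \<and> loop_sign m (loop_power g k) (s ^ n)"
      using transport_and_sign_loop_npower[OF L gloop Lg s] transport_and_sign_loop_npower[OF L rev Lrev loop_sign_reverse[OF s]]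
      unfolding loop_power_def by (cases "0 \<le> k") auto
    moreover have "L (loop_power g k) = L l"
      using L k unfolding local_system_def by blast
    ultimately show ?thesis using loop_sign_homotopic[OF k] by metis
  qed
  have "g 0 \<in> topspace (RP m)" "h 0 \<in> topspace (RP m)"
    using gloop h path_start_in_topspace unfolding loopin_def by blast+
  then obtain u v where u: "pathin (RP m) u" "u 0 = g 0" "u 1 = h 0"
    and v: "pathin (RP m) v" "v 0 = h 0" "v 1 = g 0"
    using path_connected_RP unfolding path_connected_space_def by metis
  obtain \<alpha> where \<alpha>: "is_lift m u \<alpha>" using u(1) path_lift_exists by blast
  then have "antipodal_pair (\<alpha> 1) = h 0" using u(3) by (simp add: is_lift_def)
  then obtain \<gamma>' where \<gamma>': "is_lift m h \<gamma>'" "\<gamma>' 0 = \<alpha> 1"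
    using lift_from[OF h(1), of "\<alpha> 1"] by metis
  obtain \<beta> where \<beta>: "is_lift m v \<beta>" "\<beta> 0 = \<alpha> 1"
    using lift_from[OF v(1), of "\<alpha> 1"] v(2) \<open>antipodal_pair (\<alpha> 1) = h 0\<close> by metis
  have \<gamma>'1: "\<gamma>' 1 = (\<lambda>i. - \<alpha> 1 i)"
  proof -
    have "antipodal_pair (\<gamma>' 0) = antipodal_pair (\<gamma> 0)" using \<gamma>' \<gamma> \<open>antipodal_pair (\<alpha> 1) = h 0\<close> by (simp add: is_lift_def)
    then show ?thesis
      unfolding antipodal_pair_eq_iff
      using lift_end_unique[OF \<gamma>'(1) \<gamma>(1)] lift_end_unique[of m h \<gamma>' "\<lambda>t i. - \<gamma> t i"] \<gamma> \<gamma>'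
      by (auto simp: is_lift_uminus)
  qed
  \<comment> \<open>A loop at \<open>g 0\<close> through \<open>h 0\<close>, without and with the detour along \<open>h\<close>. The lift of the latter continues
    after the detour with \<open>- \<beta>\<close> instead of \<open>\<beta>\<close>.\<close>
  let ?l0 = "join_paths u v" and ?l1 = "join_paths (join_paths u h) v"
  have l0: "loopin (RP m) ?l0" "?l0 0 = g 0" and l1: "loopin (RP m) ?l1" "?l1 0 = g 0"
    using u v h by (auto simp: loopin_def join_paths_ends intro!: pathin_join_paths)
  have lift0: "is_lift m ?l0 (join_paths \<alpha> \<beta>)"
    by (intro is_lift_join_paths \<alpha> \<beta>) (simp add: \<beta>)
  have lift1: "is_lift m ?l1 (join_paths (join_paths \<alpha> \<gamma>') (\<lambda>t i. - \<beta> t i))"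
    by (intro is_lift_join_paths \<alpha> \<gamma>') (simp_all add: is_lift_uminus \<beta> \<gamma>' \<gamma>'1 join_paths_ends)
  have "antipodal_pair (\<beta> 1) = antipodal_pair (\<alpha> 0)"
    using \<alpha> \<beta> u v by (simp add: is_lift_def)
  then obtain r where r: "r \<in> {1, -1}" "\<beta> 1 = (\<lambda>i. r * \<alpha> 0 i)"
    by (rule antipodal_pair_eqE)
  have "loop_sign m ?l0 r"
    unfolding loop_sign_def using r lift0 by (intro conjI exI[of _ "join_paths \<alpha> \<beta>"]) (auto simp: join_paths_ends)
  moreover have "loop_sign m ?l1 (- r)"
    unfolding loop_sign_def using r lift1
    by (intro conjI exI[of _ "join_paths (join_paths \<alpha> \<gamma>') (\<lambda>t i. - \<beta> t i)"]) (auto simp: join_paths_ends)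
  ultimately obtain n0 n1 where n0: "\<And>a. L ?l0 a = (uminus ^^ n0) a" "r = s ^ n0"
    and n1: "\<And>a. L ?l1 a = (uminus ^^ n1) a" "- r = s ^ n1"
    using loops[OF l0] loops[OF l1] by blast
  have "s = 1 \<or> s = -1" using s by (auto simp: loop_sign_def)
  then have "even n0 \<noteq> even n1" using n0(2) n1(2) r(1) by (auto simp: minus_one_power_iff split: if_splits)
  moreover have "(uminus ^^ n) a = (if even n then a else - a)" for n and a :: int
    by (induction n) auto
  ultimately have "L ?l1 a = - L ?l0 a" for a
    by (auto simp: n0 n1)
  moreover have "L ?l0 = L v \<circ> L u"
    using L u v unfolding local_system_def by metis
  moreover have "L ?l1 = L v \<circ> (L h \<circ> L u)"
  proof -
    have "L (join_paths u h) = L h \<circ> L u"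
      using L u h unfolding local_system_def by metis
    moreover have "L ?l1 = L v \<circ> L (join_paths u h)"
      using L u v h pathin_join_paths[of "RP m" u h] join_paths_ends[of u h]
      unfolding local_system_def by metis
    ultimately show ?thesis by simp
  qed
  ultimately have eq: "L v (L h (L u b)) = - L v (L u b)" for b by (metis comp_apply)
  obtain b where b: "a = L u b"
    using L u(1) unfolding local_system_def by (metis bij_pointE)
  have "L v (L h a) = L v (- a)"
    using eq[of b] by (simp add: b additive.minus[OF local_system_additive[OF L v(1)]])
  moreover have "inj (L v)"
    using L v(1) unfolding local_system_def by (blast intro: bij_is_inj)
  ultimately show ?thesis by (simp add: inj_eq)
qed

section \<open>Rotation of projective space and of its configurations\<close>

text \<open>Multiplication by \<open>exp (\<i> \<theta>)\<close>, where the coordinates \<open>2 j\<close> and \<open>2 j + 1\<close> are the real and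
  the imaginary part of a complex coordinate.\<close>

definition rotate_coordinates :: "real \<Rightarrow> (nat \<Rightarrow> real) \<Rightarrow> nat \<Rightarrow> real" where
  "rotate_coordinates \<theta> x = (\<lambda>i. cos \<theta> * x i + sin \<theta> * (if even i then - x (i + 1) else x (i - 1)))"

lemma rotate_coordinates_0: "rotate_coordinates 0 x = x" and rotate_coordinates_pi: "rotate_coordinates pi x = (\<lambda>i. - x i)"
  by (simp_all add: rotate_coordinates_def)

lemma rotate_coordinates_uminus: "rotate_coordinates \<theta> (\<lambda>i. - x i) = (\<lambda>i. - rotate_coordinates \<theta> x i)"
  by (simp add: rotate_coordinates_def fun_eq_iff)

lemma rotate_coordinates_inverse: "rotate_coordinates (- \<theta>) (rotate_coordinates \<theta> x) = x"
proof
  fix i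
  have eq: "cos \<theta> * (cos \<theta> * a) + sin \<theta> * (sin \<theta> * a) = a" for a
    using sin_cos_squared_add3[of \<theta>] by (simp add: distrib_right[symmetric] mult.assoc[symmetric])
  show "rotate_coordinates (- \<theta>) (rotate_coordinates \<theta> x) i = x i"
    using eq[of "x i"] by (cases "even i") (auto simp: rotate_coordinates_def algebra_simps odd_pos)
qed

lemma inj_rotate_coordinates: "inj (rotate_coordinates \<theta>)"
  by (rule inj_on_inverseI) (rule rotate_coordinates_inverse)

text \<open>For odd \<open>m\<close> the \<open>m + 1\<close> coordinates fall into complete pairs, and the rotation preserves the sum of
  squares of each pair.\<close>

lemma rotate_coordinates_in_nsphere:
  assumes "odd m" "x \<in> topspace (nsphere m)"
  shows "rotate_coordinates \<theta> x \<in> topspace (nsphere m)"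
proof -
  have pair: "(rotate_coordinates \<theta> x (2 * n))\<^sup>2 + (rotate_coordinates \<theta> x (2 * n + 1))\<^sup>2 = (x (2 * n))\<^sup>2 + (x (2 * n + 1))\<^sup>2" for n
  proof -
    have "(c * a - s * b)\<^sup>2 + (c * b + s * a)\<^sup>2 = (s\<^sup>2 + c\<^sup>2) * (a\<^sup>2 + b\<^sup>2)" for a b c s :: real
      by (simp add: power2_eq_square algebra_simps)
    from this[of "cos \<theta>" "x (2 * n)" "sin \<theta>" "x (2 * n + 1)"] show ?thesis by (simp add: rotate_coordinates_def)
  qed
  have norm: "(\<Sum>i<2 * n. (rotate_coordinates \<theta> x i)\<^sup>2) = (\<Sum>i<2 * n. (x i)\<^sup>2)" for n
    by (induction n) (use pair in \<open>simp_all add: add.assoc\<close>)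
  obtain n where "Suc m = 2 * n" using assms(1) by (metis evenE even_Suc)
  then have "{..m} = {..<2 * n}" by (metis lessThan_Suc_atMost)
  moreover have "rotate_coordinates \<theta> x i = 0" if "i > m" for i
  proof -
    have "x i = 0" "x (i + 1) = 0" "odd i \<Longrightarrow> x (i - 1) = 0"
      using assms that by (auto simp: topspace_nsphere elim!: oddE)
    then show ?thesis by (simp add: rotate_coordinates_def)
  qed
  ultimately show ?thesis using assms(2) norm by (simp add: topspace_nsphere)
qed

lemma image_rotate_antipodal_pair: "rotate_coordinates \<theta> ` antipodal_pair x = antipodal_pair (rotate_coordinates \<theta> x)"
  by (auto simp: antipodal_pair_def rotate_coordinates_uminus)

text \<open>The product of the antipodal quotient map with the compact unit interval is again a quotient map,
  so it suffices to check continuity on the sphere.\<close>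

lemma continuous_map_rotate_RP:
  assumes "odd m"
  shows "continuous_map (prod_topology (top_of_set {0..1}) (RP m)) (RP m) (\<lambda>(t, A). rotate_coordinates (pi * t) ` A)"
proof (rule continuous_compose_quotient_map)
  show "quotient_map (prod_topology (top_of_set {0..1}) (nsphere m)) (prod_topology (top_of_set {0..1}) (RP m))
      (\<lambda>(t::real, x). (t, antipodal_pair x))"
    by (intro quotient_map_prod_right quotient_map_RP compact_imp_locally_compact_space)
      (auto simp: Hausdorff_space_subtopology compact_space_subtopology)
  let ?Z = "prod_topology (top_of_set {0..1::real}) (nsphere m)"
  have x: "continuous_map ?Z euclideanreal (\<lambda>z. snd z i)" for i
    using continuous_map_compose[OF continuous_map_snd continuous_map_nsphere_projection] by (simp add: o_def)
  have "continuous_map ?Z (top_of_set {0..1}) fst" by (rule continuous_map_fst)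
  then have t: "continuous_map ?Z euclideanreal fst" by (simp add: continuous_map_in_subtopology)
  have trig: "continuous_map ?Z euclideanreal (\<lambda>z. cos (pi * fst z))" "continuous_map ?Z euclideanreal (\<lambda>z. sin (pi * fst z))"
  proof -
    have "continuous_on UNIV (\<lambda>t::real. cos (pi * t))" "continuous_on UNIV (\<lambda>t::real. sin (pi * t))"
      by (intro continuous_intros)+
    then show "continuous_map ?Z euclideanreal (\<lambda>z. cos (pi * fst z))"
        "continuous_map ?Z euclideanreal (\<lambda>z. sin (pi * fst z))"
      using continuous_map_compose[OF t, of euclideanreal "\<lambda>t. cos (pi * t)"]
        continuous_map_compose[OF t, of euclideanreal "\<lambda>t. sin (pi * t)"] by (simp_all add: o_def)
  qed
  have "continuous_map ?Z euclideanreal (\<lambda>z. rotate_coordinates (pi * fst z) (snd z) i)" for i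
    by (cases "even i") (simp_all add: rotate_coordinates_def, (intro continuous_map_add continuous_map_diff continuous_map_real_mult x trig)+)
  then have "continuous_map ?Z (nsphere m) (\<lambda>z. rotate_coordinates (pi * fst z) (snd z))"
    using assms by (auto simp: continuous_map_into_nsphere rotate_coordinates_in_nsphere)
  from continuous_map_compose[OF this quotient_imp_continuous_map[OF quotient_map_RP]]
  show "continuous_map ?Z (RP m) ((\<lambda>(t, A). rotate_coordinates (pi * t) ` A) \<circ> (\<lambda>(t, x). (t, antipodal_pair x)))"
    by (simp add: o_def case_prod_beta' image_rotate_antipodal_pair)
qed

definition rotate_configuration :: "nat \<Rightarrow> real \<times> (nat \<Rightarrow> (nat \<Rightarrow> real) set) \<Rightarrow> nat \<Rightarrow> (nat \<Rightarrow> real) set" where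
  "rotate_configuration N = (\<lambda>(t, c). \<lambda>i\<in>{..<N}. rotate_coordinates (pi * t) ` c i)"

lemma continuous_map_configuration_component:
  "i < N \<Longrightarrow> continuous_map (configuration_space X N) X (\<lambda>c. c i)"
  unfolding configuration_space_def
  by (intro continuous_map_from_subtopology continuous_map_product_projection) simp

lemma continuous_map_into_configuration_space:
  "continuous_map Z (configuration_space X N) f \<longleftrightarrow>
     (\<forall>i<N. continuous_map Z X (\<lambda>z. f z i)) \<and>
     (\<forall>z\<in>topspace Z. f z \<in> extensional {..<N} \<and> inj_on (f z) {..<N})"
  by (auto simp: configuration_space_def continuous_map_in_subtopology continuous_map_componentwise)

lemma continuous_map_rotate_configuration:
  assumes "odd m"
  shows "continuous_map (prod_topology (top_of_set {0..1}) (configuration_space (RP m) N))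
           (configuration_space (RP m) N) (rotate_configuration N)"
proof -
  let ?C = "configuration_space (RP m) N"
  let ?Z = "prod_topology (top_of_set {0..1::real}) ?C"
  have "continuous_map ?Z (RP m) (\<lambda>z. rotate_configuration N z i)" if "i < N" for i
  proof -
    have "continuous_map ?Z (prod_topology (top_of_set {0..1}) (RP m)) (\<lambda>z. (fst z, snd z i))"
      using continuous_map_compose[OF continuous_map_snd continuous_map_configuration_component[OF that]]
      by (simp add: continuous_map_pairwise o_def continuous_map_fst)
    from continuous_map_compose[OF this continuous_map_rotate_RP[OF assms]] show ?thesis
      using that by (simp add: o_def rotate_configuration_def case_prod_beta')
  qed
  moreover have "inj_on (rotate_configuration N z) {..<N}" if "z \<in> topspace ?Z" for z
  proof -
    have "inj_on (snd z) {..<N}" using that by (auto simp: configuration_space_def)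
    moreover have "inj (image (rotate_coordinates (pi * fst z)))" using inj_rotate_coordinates by (simp add: inj_image_eq_iff inj_def)
    ultimately have "inj_on (image (rotate_coordinates (pi * fst z)) \<circ> snd z) {..<N}"
      by (intro comp_inj_on) (auto intro: inj_on_subset)
    then show ?thesis
      by (rule inj_on_cong[THEN iffD1, rotated]) (simp add: rotate_configuration_def case_prod_beta')
  qed
  ultimately show ?thesis
    unfolding continuous_map_into_configuration_space by (auto simp: rotate_configuration_def)
qed

text \<open>Half a turn carries a point of the sphere to its antipode, so the track of a point of projective
  space is a loop with an open lift.\<close>

lemma transport_rotation_trajectory:
  fixes L :: "((nat \<Rightarrow> real) set, int) transport"
  assumes "odd m" "local_system (RP m) L" "generates_fundamental_group (RP m) g"
    and "\<And>a. L g a = - a" and "A \<in> topspace (RP m)"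
  shows "L (\<lambda>t. rotate_coordinates (pi * t) ` A) a = - a"
proof -
  obtain x where x: "x \<in> topspace (nsphere m)" "A = antipodal_pair x"
    using assms(5) by (auto simp: topspace_RP)
  have "continuous_on {0..1} (\<lambda>t. rotate_coordinates (pi * t) x i)" for i
    by (cases "even i") (auto simp: rotate_coordinates_def intro!: continuous_intros)
  then have "is_lift m (\<lambda>t. rotate_coordinates (pi * t) ` A) (\<lambda>t. rotate_coordinates (pi * t) x)"
    using x assms(1) by (auto simp: is_lift_def pathin_def continuous_map_into_nsphere
        rotate_coordinates_in_nsphere image_rotate_antipodal_pair)
  then show ?thesis
    by (rule transport_loop_with_open_lift[OF assms(2-4)]) (simp add: rotate_coordinates_0 rotate_coordinates_pi)
qed

text \<open>Rotating all points of a configuration simultaneously keeps them distinct. Each of the \<open>N\<close> points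
  contributes a factor \<open>-1\<close> to the transport, and \<open>N\<close> is odd.\<close>

lemma inverting_homotopy_rotate_configuration:
  assumes "odd m" and "odd N"
    and L: "local_system (RP m) L"
    and "generates_fundamental_group (RP m) g"
    and "\<And>a. L g a = - a"
  shows "inverting_homotopy (configuration_space (RP m) N)
           (rationalize_system (external_tensor_power N L)) (rotate_configuration N)"
    (is "inverting_homotopy ?C ?L ?H")
proof
  show "continuous_map (prod_topology (top_of_set {0..1}) ?C) ?C ?H"
    by (rule continuous_map_rotate_configuration) fact
  fix c assume c: "c \<in> topspace ?C"
  then have ext: "c \<in> extensional {..<N}" and point: "\<And>i. i < N \<Longrightarrow> c i \<in> topspace (RP m)"
    by (auto simp: configuration_space_def PiE_iff)
  show "?H (0, c) = c"
    using ext by (auto simp: rotate_configuration_def rotate_coordinates_0 extensional_def fun_eq_iff)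
  show "?H (1, c) = c"
  proof
    fix i
    show "?H (1, c) i = c i"
    proof (cases "i < N")
      case True
      then obtain x where "c i = antipodal_pair x" using point by (auto simp: topspace_RP)
      moreover have "rotate_coordinates pi ` antipodal_pair x = antipodal_pair x"
        unfolding image_rotate_antipodal_pair by (simp add: rotate_coordinates_pi)
      ultimately show ?thesis using True by (simp add: rotate_configuration_def)
    qed (use ext in \<open>auto simp: rotate_configuration_def extensional_def\<close>)
  qed
  have "L (\<lambda>t. ?H (t, c) i) 1 = - 1" if "i < N" for i
    using transport_rotation_trajectory[OF assms(1,3,4,5) point[OF that]] that
    by (simp add: rotate_configuration_def)
  then show "?L (\<lambda>t. ?H (t, c)) q = - q" for q
    using \<open>odd N\<close>
    by (simp add: rationalize_system_def external_tensor_power_def tensor_system_def pullback_system_def o_def)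
next
  show "?L h (a + b) = ?L h a + ?L h b" for h a b
    by (simp add: rationalize_system_def distrib_left)
next
  fix h h' assume paths: "pathin ?C h" "pathin ?C h'" and eq: "\<And>t. t \<in> {0..1} \<Longrightarrow> h t = h' t"
  have "L ((\<lambda>c. c i) \<circ> h) = L ((\<lambda>c. c i) \<circ> h')" if "i < N" for i
    using pathin_compose[OF paths(1) continuous_map_configuration_component[OF that]] eq
    by (intro local_system_cong[OF L]) auto
  then show "?L h = ?L h'"
    by (simp add: rationalize_system_def external_tensor_power_def tensor_system_def pullback_system_def
        cong: prod.cong_simp)
qed

theorem theorem7:
  fixes m N :: nat
    and L :: "((nat \<Rightarrow> real) set, int) transport"
    and g :: "real \<Rightarrow> (nat \<Rightarrow> real) set"
  assumes "odd m" and "odd N"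
    and "local_system (RP m) L"
    and "generates_fundamental_group (RP m) g"
    and "\<And>a. L g a = - a"
  shows "\<forall>p. trivial_group
           (local_homology_group (configuration_space (RP m) N)
              (rationalize_system (external_tensor_power N L)) p)"
  using inverting_homotopy_rotate_configuration[OF assms] trivial_rational_local_homology_group by blast

end
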